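(* Let $(C_n)$ be a Markov chain on a discrete state space ${\cal S}$ with transition matrix $P=(p(x,y), x,y\in{\cal S})$, which is aperiodic, irreducible, without loops (that is, $p(x,x)=0$ for all $x\in{\cal S}$) and has an invariant measure $\pi$ (it is not assumed that $\pi$ has a finite mass). Let $(C_n,M_n)$ be the associated cat and mouse Markov chain, $\nu$ its invariant measure defined in the context, and $\nu_2$ the marginal of $\nu$ on the second coordinate. If $(C_n)$ is a reversible Markov chain then, for $y\in{\cal S}$, the relation $$\nu_2(y)=1-\pi(y)$$ holds. If the state space ${\cal S}$ is countably infinite, the Markov chain $(C_n,M_n)$ is then null recurrent.
   Context: The cat and mouse Markov chain $(C_n,M_n)$ associated with $P$ is the Markov chain on ${\cal S}\times{\cal S}$ with transition matrix $Q=(q(\cdot,\cdot))$ given, for $x,y,z,w\in{\cal S}$, by $q[(x,y),(z,y)]=p(x,z)$ if $x\neq y$, and $q[(y,y),(z,w)]=p(y,z)p(y,w)$; all other transitions have probability $0$. Its first coordinate is a Markov chain with transition matrix $P$. $(C_n^* )$ denotes the reversed Markov chain, with transition matrix $p^*(x,y)=\frac{\pi(y)}{\pi(x)}p(y,x)$; for $y\in{\cal S}$, $H_y^*=\inf\{n>0: C_n^*=y\}$, and $\mathbb{E}_x$ denotes expectation when the chain starts at $x$. The measure $\nu$ on ${\cal S}\times{\cal S}$ is defined by $$\nu(x,y)=\pi(x)\,\mathbb{E}_x\Bigl(\sum_{n=1}^{H_y^*}p(C_n^*,y)\Bigr),\qquad x,y\in{\cal S};$$ it is an invariant measure of $(C_n,M_n)$.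 Its second marginal is $\nu_2(y)=\sum_{x\in{\cal S}}\nu(x,y)$, $y\in{\cal S}$. Reversible means $\pi(x)p(x,y)=\pi(y)p(y,x)$ for all $x,y\in{\cal S}$. The chain $(C_n,M_n)$ has only one irreducible component. Recurrence of $(C_n,M_n)$ means that, with probability $1$, the elements of ${\cal S}\times{\cal S}$ for which $\nu$ is nonzero are visited infinitely often, $\nu$ being the unique invariant measure up to a multiplicative coefficient; null recurrent means recurrent with an invariant measure of infinite total mass.
   Formalization: The relation ν₂(y)=1−π(y) is proved when π has total mass 1 (in general ν₂(y) is the total mass minus π(y), or infinite); null recurrence is proved when π has finite mass or (C_n) is recurrent, since it fails for transient (C_n). *)

theory Defs
  imports "HOL-Probability.Probability"
begin

text \<open>
  A Markov chain on a discrete state space is given by a kernel \<open>K\<close>, the transition matrix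
  being \<open>p(x,y) = pmf (K x) y\<close>. The state space is the whole type, of class \<open>countable\<close> and
  possibly finite. A measure on it is given by its point masses, which are finite, while the
  total mass may be infinite.
\<close>

subsection \<open>Law of a Markov chain on the space of trajectories\<close>

definition step_kernel :: "('s \<Rightarrow> 's pmf) \<Rightarrow> 's \<Rightarrow> nat \<Rightarrow> (nat \<Rightarrow> 's) \<Rightarrow> 's measure" where
  "step_kernel K x i \<omega> =
     (if i = 0 then return (count_space UNIV) x else measure_pmf (K (\<omega> (i - 1))))"

definition paths :: "('s \<Rightarrow> 's pmf) \<Rightarrow> 's \<Rightarrow> (nat \<Rightarrow> 's) measure" where
  "paths K x =
     projective_family.lim UNIV
       (Ionescu_Tulcea.CI (step_kernel K x) (\<lambda>_. count_space UNIV)) (\<lambda>_. count_space UNIV)"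

lemma Ionescu_Tulcea_step_kernel:
  "Ionescu_Tulcea (step_kernel K x) (\<lambda>_. count_space UNIV)"
proof (rule Ionescu_Tulcea.intro)
  fix i :: nat
  have *: "(\<lambda>\<omega>. measure_pmf (K (\<omega> (i - 1)))) \<in>
      PiM {0..<i} (\<lambda>_. count_space UNIV) \<rightarrow>\<^sub>M subprob_algebra (count_space UNIV)" if "i > 0"
  proof (rule measurable_compose[of "\<lambda>\<omega>. \<omega> (i - 1)" _ "count_space UNIV" "\<lambda>a. measure_pmf (K a)"])
    show "(\<lambda>\<omega>. \<omega> (i - 1)) \<in> PiM {0..<i} (\<lambda>_. count_space UNIV) \<rightarrow>\<^sub>M count_space UNIV"
      using that by (intro measurable_component_singleton) auto
    show "(\<lambda>a. measure_pmf (K a)) \<in> count_space UNIV \<rightarrow>\<^sub>M subprob_algebra (count_space UNIV)"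
      by (auto simp: space_subprob_algebra intro!: measure_pmf.subprob_space_axioms)
  qed
  show "step_kernel K x i \<in>
      PiM {0..<i} (\<lambda>_. count_space UNIV) \<rightarrow>\<^sub>M subprob_algebra (count_space UNIV)"
  proof (cases "i = 0")
    case True
    then have "step_kernel K x i = (\<lambda>_. return (count_space UNIV) x)"
      by (simp add: step_kernel_def fun_eq_iff)
    then show ?thesis
      by (auto simp: space_subprob_algebra
               intro!: prob_space_imp_subprob_space prob_space_return)
  next
    case False
    then have "step_kernel K x i = (\<lambda>\<omega>. measure_pmf (K (\<omega> (i - 1))))"
      by (simp add: step_kernel_def fun_eq_iff)
    with False * show ?thesis by simp
  qed
next
  fix i :: nat and \<omega> :: "nat \<Rightarrow> 'a"
  show "prob_space (step_kernel K x i \<omega>)"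
    by (auto simp: step_kernel_def prob_space_return measure_pmf.prob_space_axioms)
qed

lemma emeasure_paths_cylinder:
  "emeasure (paths K x) {\<omega>. \<forall>i\<le>n. \<omega> i = s i} =
     (if s 0 = x then ennreal (\<Prod>i<n. pmf (K (s i)) (s (Suc i))) else 0)"
proof -
  let ?M = "\<lambda>_::nat. count_space (UNIV :: 'a set)"
  interpret IT: Ionescu_Tulcea "step_kernel K x" ?M
    by (rule Ionescu_Tulcea_step_kernel)
  let ?A = "\<lambda>n. PiE {0..<n} (\<lambda>i. {s i})"
  let ?u = "\<lambda>_::nat. undefined :: 'a"
  have A[measurable]: "?A n \<in> sets (PiM {0..<n} ?M)" for n
    by (intro sets_PiM_I_finite) auto
  have u[simp]: "?u \<in> space (PiM {0..<0} ?M)"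
    by (simp add: space_PiM)
  have C: "emeasure (IT.C 0 (Suc n) ?u) (?A (Suc n)) =
      emeasure (IT.C 0 n ?u) (?A n) * emeasure (step_kernel K x n s) {s n}" for n
  proof -
    have "emeasure (IT.C 0 (Suc n) ?u) (?A (Suc n)) =
        (\<integral>\<^sup>+\<omega>. emeasure (IT.eP n \<omega>) (?A (Suc n)) \<partial>IT.C 0 n ?u)"
      using IT.space_C[OF u, of n] IT.sets_C[OF u, of n]
      by (simp del: IT.C.simps add: IT.C.simps(2))
         (subst emeasure_bind[where N="PiM {0..<Suc n} ?M"];
          auto simp: space_PiM measurable_cong_sets[OF IT.sets_C[OF u] refl])
    also have "\<dots> = (\<integral>\<^sup>+\<omega>. emeasure (step_kernel K x n s) {s n} * indicator (?A n) \<omega> \<partial>IT.C 0 n ?u)"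
    proof (rule nn_integral_cong)
      fix \<omega> assume "\<omega> \<in> space (IT.C 0 n ?u)"
      then have \<omega>: "\<omega> \<in> space (PiM {0..<n} ?M)"
        using IT.space_C[OF u, of n] by simp
      then have ext: "\<omega> \<in> extensional {0..<n}"
        by (simp add: space_PiM PiE_def)
      have vi: "fun_upd \<omega> n -` ?A (Suc n) \<inter> space (?M n) = (if \<omega> \<in> ?A n then {s n} else {})"
        using ext by (auto simp: PiE_iff extensional_def less_Suc_eq Ball_def split: if_splits)
      have st: "step_kernel K x n \<omega> = step_kernel K x n s" if "\<omega> \<in> ?A n"
        using that by (cases n) (auto simp: step_kernel_def PiE_iff)
      show "emeasure (IT.eP n \<omega>) (?A (Suc n)) =
          emeasure (step_kernel K x n s) {s n} * indicator (?A n) \<omega>"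
        unfolding IT.emeasure_eP[OF \<omega> A] vi using st by auto
    qed
    also have "\<dots> = emeasure (IT.C 0 n ?u) (?A n) * emeasure (step_kernel K x n s) {s n}"
      using IT.sets_C[OF u, of n]
      by (subst nn_integral_cmult_indicator) (auto simp: mult.commute)
    finally show ?thesis .
  qed
  have rec: "emeasure (IT.C 0 (Suc n) ?u) (?A (Suc n)) =
      (if s 0 = x then ennreal (\<Prod>i<n. pmf (K (s i)) (s (Suc i))) else 0)" for n
  proof (induction n)
    case 0
    show ?case
      by (subst C) (auto simp: step_kernel_def emeasure_return space_PiM PiM_empty)
  next
    case (Suc n)
    show ?case
      by (subst C, subst Suc)
         (auto simp: step_kernel_def emeasure_pmf_single ennreal_mult' prod_nonneg)
  qed
  have eq: "{\<omega>. \<forall>i\<le>n. \<omega> i = s i} = prod_emb UNIV ?M {0..<Suc n} (?A (Suc n))"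
    by (auto simp: prod_emb_def space_PiM PiE_iff less_Suc_eq_le)
  have "emeasure (paths K x) {\<omega>. \<forall>i\<le>n. \<omega> i = s i} = emeasure (IT.CI {0..<Suc n}) (?A (Suc n))"
    unfolding paths_def eq by (rule IT.lim) auto
  also have "\<dots> = emeasure (IT.C 0 (Suc n) ?u) (prod_emb {0..<Suc n} ?M {0..<Suc n} (?A (Suc n)))"
    by (rule IT.emeasure_CI) auto
  also have "prod_emb {0..<Suc n} ?M {0..<Suc n} (?A (Suc n)) = ?A (Suc n)"
    by (rule prod_emb_id) auto
  finally show ?thesis using rec by simp
qed


subsection \<open>Standard notions\<close>

primrec nstep :: "('s \<Rightarrow> 's pmf) \<Rightarrow> nat \<Rightarrow> 's \<Rightarrow> 's pmf" where
  "nstep K 0 x = return_pmf x"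
| "nstep K (Suc n) x = bind_pmf (nstep K n x) K"

definition irreducible_chain :: "('s \<Rightarrow> 's pmf) \<Rightarrow> bool" where
  "irreducible_chain K \<longleftrightarrow> (\<forall>x y. \<exists>n. pmf (nstep K n x) y > 0)"

definition aperiodic_chain :: "('s \<Rightarrow> 's pmf) \<Rightarrow> bool" where
  "aperiodic_chain K \<longleftrightarrow> (\<forall>x. Gcd {n. n > 0 \<and> pmf (nstep K n x) x > 0} = 1)"

definition loopless_chain :: "('s \<Rightarrow> 's pmf) \<Rightarrow> bool" where
  "loopless_chain K \<longleftrightarrow> (\<forall>x. pmf (K x) x = 0)"

definition invariant_measure :: "('s \<Rightarrow> 's pmf) \<Rightarrow> ('s \<Rightarrow> ennreal) \<Rightarrow> bool" where
  "invariant_measure K \<mu> \<longleftrightarrow>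
     (\<exists>x. \<mu> x \<noteq> 0) \<and> (\<forall>x. \<mu> x < \<infinity>) \<and>
     (\<forall>y. (\<integral>\<^sup>+x. \<mu> x * pmf (K x) y \<partial>count_space UNIV) = \<mu> y)"

definition total_mass :: "('s \<Rightarrow> ennreal) \<Rightarrow> ennreal" where
  "total_mass \<mu> = (\<integral>\<^sup>+x. \<mu> x \<partial>count_space UNIV)"

definition reversible_chain :: "('s \<Rightarrow> 's pmf) \<Rightarrow> ('s \<Rightarrow> ennreal) \<Rightarrow> bool" where
  "reversible_chain K \<pi> \<longleftrightarrow> (\<forall>x y. \<pi> x * pmf (K x) y = \<pi> y * pmf (K y) x)"

definition visits_infinitely_often :: "('s \<Rightarrow> 's pmf) \<Rightarrow> 's set \<Rightarrow> bool" where
  "visits_infinitely_often K A \<longleftrightarrow>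
     (\<forall>x. AE \<omega> in paths K x. \<forall>y\<in>A. \<exists>\<^sub>\<infinity>n. \<omega> n = y)"

text \<open>Recurrence of an irreducible chain.\<close>

definition recurrent_chain :: "('s \<Rightarrow> 's pmf) \<Rightarrow> bool" where
  "recurrent_chain K \<longleftrightarrow> visits_infinitely_often K UNIV"

text \<open>
  Recurrence of a chain with one irreducible component, which need not be the whole space: the
  component is the set of states charged by the invariant measure \<open>\<mu>\<close>, and the chain may start
  outside of it.
\<close>

definition recurrent_with :: "('s \<Rightarrow> 's pmf) \<Rightarrow> ('s \<Rightarrow> ennreal) \<Rightarrow> bool" where
  "recurrent_with K \<mu> \<longleftrightarrow>
     invariant_measure K \<mu> \<and>
     (\<forall>\<mu>'. invariant_measure K \<mu>' \<longrightarrow> (\<exists>c. \<mu>' = (\<lambda>x. c * \<mu> x))) \<and>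
     visits_infinitely_often K {x. \<mu> x \<noteq> 0}"

definition null_recurrent_with :: "('s \<Rightarrow> 's pmf) \<Rightarrow> ('s \<Rightarrow> ennreal) \<Rightarrow> bool" where
  "null_recurrent_with K \<mu> \<longleftrightarrow> recurrent_with K \<mu> \<and> total_mass \<mu> = \<infinity>"


subsection \<open>The cat and mouse chain\<close>

fun cat_mouse :: "('s \<Rightarrow> 's pmf) \<Rightarrow> 's \<times> 's \<Rightarrow> ('s \<times> 's) pmf" where
  "cat_mouse K (x, y) =
     (if x = y then pair_pmf (K y) (K y) else map_pmf (\<lambda>z. (z, y)) (K x))"

lemma pmf_cat_mouse_eq: "pmf (cat_mouse K (y, y)) (z, w) = pmf (K y) z * pmf (K y) w"
  by (simp add: pmf_pair)

lemma pmf_cat_mouse_neq: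
  assumes "x \<noteq> y"
  shows "pmf (cat_mouse K (x, y)) (z, w) = (if w = y then pmf (K x) z else 0)"
proof -
  have "pmf (map_pmf (\<lambda>z. (z, y)) (K x)) (z, y) = pmf (K x) z"
    by (rule pmf_map_inj') (simp add: inj_on_def)
  moreover have "pmf (map_pmf (\<lambda>z. (z, y)) (K x)) (z, w) = 0" if "w \<noteq> y"
    using that by (auto simp: pmf_eq_0_set_pmf)
  ultimately show ?thesis
    using assms by auto
qed

text \<open>
  The function given to \<open>embed_pmf\<close> is a probability mass function as soon as \<open>\<pi>\<close> is an
  invariant measure and \<open>\<pi> x \<noteq> 0\<close>; the latter always holds if \<open>K\<close> is irreducible.
\<close>

definition reversed :: "('s \<Rightarrow> 's pmf) \<Rightarrow> ('s \<Rightarrow> ennreal) \<Rightarrow> 's \<Rightarrow> 's pmf" where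
  "reversed K \<pi> x = embed_pmf (\<lambda>y. enn2real (\<pi> y / \<pi> x) * pmf (K y) x)"

lemma pmf_reversed:
  assumes "invariant_measure K \<pi>" "\<pi> x \<noteq> 0"
  shows "pmf (reversed K \<pi> x) y = enn2real (\<pi> y / \<pi> x) * pmf (K y) x"
  unfolding reversed_def
proof (rule pmf_embed_pmf)
  have fin: "\<pi> z < \<infinity>" for z
    using assms by (auto simp: invariant_measure_def)
  have "ennreal (enn2real (\<pi> z / \<pi> x) * pmf (K z) x) = \<pi> z * pmf (K z) x / \<pi> x" for z
  proof -
    have "\<pi> z / \<pi> x < \<infinity>"
      using fin[of z] assms(2) ennreal_divide_eq_top_iff[of "\<pi> z" "\<pi> x"]
      by (metis infinity_ennreal_def less_irrefl top.not_eq_extremum)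
    then show ?thesis
      by (simp add: ennreal_mult' divide_ennreal_def ac_simps)
  qed
  then have "(\<integral>\<^sup>+z. ennreal (enn2real (\<pi> z / \<pi> x) * pmf (K z) x) \<partial>count_space UNIV) =
      (\<integral>\<^sup>+z. \<pi> z * pmf (K z) x \<partial>count_space UNIV) / \<pi> x"
    by (simp add: nn_integral_divide)
  also have "\<dots> = 1"
    using assms fin[of x] by (simp add: invariant_measure_def ennreal_divide_self)
  finally show "(\<integral>\<^sup>+z. ennreal (enn2real (\<pi> z / \<pi> x) * pmf (K z) x) \<partial>count_space UNIV) = 1" .
qed simp

text \<open>The infimum over the empty set is \<open>\<infinity>\<close>.\<close>

definition hitting_time :: "'s \<Rightarrow> (nat \<Rightarrow> 's) \<Rightarrow> enat" where
  "hitting_time y \<omega> = Inf {enat n | n. n > 0 \<and> \<omega> n = y}"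

text \<open>
  The trajectory \<open>\<omega>\<close> is that of the reversed chain, but the summand \<open>p(\<omega> n, y)\<close> is the
  transition probability of the original one.
\<close>

definition cm_measure :: "('s \<Rightarrow> 's pmf) \<Rightarrow> ('s \<Rightarrow> ennreal) \<Rightarrow> 's \<times> 's \<Rightarrow> ennreal" where
  "cm_measure K \<pi> = (\<lambda>(x, y).
     \<pi> x * (\<integral>\<^sup>+\<omega>. (\<Sum>n. if 1 \<le> n \<and> enat n \<le> hitting_time y \<omega>
                        then ennreal (pmf (K (\<omega> n)) y) else 0) \<partial>paths (reversed K \<pi>) x))"

definition cm_marginal2 :: "('s \<Rightarrow> 's pmf) \<Rightarrow> ('s \<Rightarrow> ennreal) \<Rightarrow> 's \<Rightarrow> ennreal" where
  "cm_marginal2 K \<pi> y = (\<integral>\<^sup>+x. cm_measure K \<pi> (x, y) \<partial>count_space UNIV)"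

end

theory Submission
  imports Defs
begin

text \<open>
  Write \<open>p(x, y)\<close> for the transition probabilities and \<open>\<nu>\<close> for \<open>cm_measure K \<pi>\<close>. By reversibility the reversed
  chain is the chain itself, so the \<open>n\<close>-th summand \<open>p(C\<^sub>n, y)\<close> in the definition of \<open>\<nu>(x, y)\<close>, restricted to the
  event that \<open>y\<close> is not visited at the times \<open>1, ..., n - 1\<close>, has as its expectation the probability that the
  first visit to \<open>y\<close> at a positive time takes place at \<open>n + 1\<close> (a visit at time \<open>n\<close> contributes \<open>p(y, y) = 0\<close>).
  The sum over \<open>n \<ge> 1\<close> is the probability that this visit takes place, but not at time 1; since the chain is
  recurrent,
    \<open>\<nu>(x, y) = \<pi>(x) (1 - p(x, y))\<close>
  (\<open>cm_measure_reversible\<close>). Summing over \<open>x\<close> and using that \<open>\<pi>\<close> is invariant yields \<open>\<nu>\<^sub>2(y) + \<pi>(y) = |\<pi>|\<close>, where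
  \<open>|\<pi>|\<close> is the total mass. This is the marginal formula when \<open>|\<pi>| = 1\<close>, and it shows that \<open>\<nu>\<close> has infinite
  mass when there are infinitely many states (\<open>total_mass_cat_mouse\<close>).

  From the explicit formula the invariance of \<open>\<nu>\<close> is a short computation (\<open>cat_mouse_invariant\<close>). Recurrence
  rests on the remark that the successive places where the cat meets the mouse form a chain with the transition
  matrix \<open>p\<close>, because the cat, being recurrent, always reaches the state to which the mouse has jumped. Hence every
  diagonal state \<open>(a, a)\<close> is hit with probability 1 from everywhere (\<open>hit_ever_cat_mouse_diagonal\<close>).

  For any chain with such a state, uniqueness of the invariant measure and almost sure infinitely many visits to
  every state that it charges follow from the rigidity of excessive measures and from a zero-one law for hitting
  probabilities (\<open>recurrence_from_one_state\<close>). All this is carried out with hitting probabilities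
  defined by first-step recursion; the Markov property of the trajectory law (\<open>paths_first_step\<close>) translates
  between them and almost sure statements. Recurrence of the original chain is assumed or, if \<open>\<pi>\<close> is
  finite, a consequence of irreducibility (\<open>finite_invariant_hit_ever\<close>).
\<close>

section \<open>Hitting probabilities\<close>

text \<open>
  The values are taken in \<open>ennreal\<close> so that they combine directly with \<open>nn_integral\<close>. Defining the
  hitting probabilities through first-step analysis, rather than as probabilities of events, lets
  all the recurrence arguments below proceed by induction on the number of steps; that these
  really are the probabilities of visiting \<open>a\<close> is \<open>emeasure_paths_hit_within\<close>.
\<close>

primrec hit_within :: "('s \<Rightarrow> 's pmf) \<Rightarrow> 's \<Rightarrow> nat \<Rightarrow> 's \<Rightarrow> ennreal" where
  "hit_within K a 0 x = (if x = a then 1 else 0)"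
| "hit_within K a (Suc n) x = (if x = a then 1 else \<integral>\<^sup>+z. hit_within K a n z \<partial>measure_pmf (K x))"

definition hit_ever :: "('s \<Rightarrow> 's pmf) \<Rightarrow> 's \<Rightarrow> 's \<Rightarrow> ennreal" where
  "hit_ever K a x = (SUP n. hit_within K a n x)"

lemma hit_within_self [simp]: "hit_within K a n a = 1"
  by (cases n) auto

lemma hit_ever_self [simp]: "hit_ever K a a = 1"
  by (simp add: hit_ever_def)

lemma nn_integral_pmf_le_1:
  assumes "\<And>z. f z \<le> 1"
  shows "(\<integral>\<^sup>+z. f z \<partial>measure_pmf p) \<le> 1"
proof -
  have "(\<integral>\<^sup>+z. f z \<partial>measure_pmf p) \<le> (\<integral>\<^sup>+z. 1 \<partial>measure_pmf p)"
    by (intro nn_integral_mono assms)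
  then show ?thesis by simp
qed

lemma hit_within_le_1: "hit_within K a n x \<le> 1"
  by (induction n arbitrary: x) (auto intro: nn_integral_pmf_le_1)

lemma hit_ever_le_1: "hit_ever K a x \<le> 1"
  unfolding hit_ever_def by (intro SUP_least hit_within_le_1)

lemma incseq_hit_within: "incseq (hit_within K a)"
proof (rule incseq_SucI)
  fix n
  have "hit_within K a n x \<le> hit_within K a (Suc n) x" for x
  proof (induction n arbitrary: x)
    case (Suc n)
    then show ?case
      by (cases "x = a") (auto simp del: hit_within.simps simp: hit_within.simps(2) intro!: nn_integral_mono)
  qed auto
  then show "hit_within K a n \<le> hit_within K a (Suc n)"
    by (simp add: le_fun_def)
qed

lemma hit_within_le_hit_ever: "hit_within K a n x \<le> hit_ever K a x"
  unfolding hit_ever_def by (rule SUP_upper) simp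

lemma nn_integral_hit_ever:
  "(\<integral>\<^sup>+z. hit_ever K a z \<partial>measure_pmf p) = (SUP n. \<integral>\<^sup>+z. hit_within K a n z \<partial>measure_pmf p)"
  unfolding hit_ever_def
  by (rule nn_integral_monotone_convergence_SUP) (auto intro: incseq_hit_within)

lemma hit_ever_step:
  assumes "x \<noteq> a"
  shows "hit_ever K a x = (\<integral>\<^sup>+z. hit_ever K a z \<partial>measure_pmf (K x))"
proof -
  have "incseq (\<lambda>n. hit_within K a n x)"
    using incseq_hit_within[of K a] by (auto simp: incseq_def le_fun_def)
  then have "hit_within K a n x \<le> hit_within K a (Suc n) x" for n
    by (rule incseq_SucD)
  then have "hit_ever K a x = (SUP n. hit_within K a (Suc n) x)"
    unfolding hit_ever_def by (intro antisym SUP_mono) (blast intro: order_refl)+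
  then show ?thesis
    using assms by (simp add: nn_integral_hit_ever)
qed

lemma hit_ever_superharmonic: "(\<integral>\<^sup>+z. hit_ever K a z \<partial>measure_pmf (K x)) \<le> hit_ever K a x"
proof (cases "x = a")
  case True
  then show ?thesis by (simp add: nn_integral_pmf_le_1 hit_ever_le_1)
qed (simp add: hit_ever_step)

text \<open>
  A nonnegative superharmonic function decreases on average until \<open>a\<close> is reached, and is worth
  \<open>f a\<close> there. When \<open>a\<close> is hit with probability 1 this gives the minimum principle
  \<open>f a \<le> f x\<close>, the form in which it is mostly used.
\<close>

lemma superharmonic_ge_hit_ever:
  assumes "\<And>x. x \<noteq> a \<Longrightarrow> (\<integral>\<^sup>+z. f z \<partial>measure_pmf (K x)) \<le> f x"
  shows "f a * hit_ever K a x \<le> f x"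
proof -
  have "f a * hit_within K a n x \<le> f x" for n
  proof (induction n arbitrary: x)
    case (Suc n)
    show ?case
    proof (cases "x = a")
      case False
      then have "f a * hit_within K a (Suc n) x = (\<integral>\<^sup>+z. f a * hit_within K a n z \<partial>measure_pmf (K x))"
        by (simp add: nn_integral_cmult)
      also have "\<dots> \<le> (\<integral>\<^sup>+z. f z \<partial>measure_pmf (K x))"
        by (intro nn_integral_mono Suc)
      also have "\<dots> \<le> f x"
        by (rule assms[OF False])
      finally show ?thesis .
    qed simp
  qed simp
  then show ?thesis
    by (simp add: hit_ever_def SUP_mult_left_ennreal SUP_least)
qed

text \<open>
  A zero-one law. Let \<open>h\<close> be the probability of hitting \<open>t\<close> and \<open>c = h a\<close>. As \<open>a\<close> is always visited,
  \<open>c\<close> is the minimum of \<open>h\<close>. The function \<open>h - c\<close> is then nonnegative, harmonic off \<open>t\<close> and equal to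
  \<open>1 - c\<close> at \<open>t\<close>, whence \<open>h - c \<ge> (1 - c) h\<close>; at \<open>a\<close> this reads \<open>0 \<ge> (1 - c) c\<close>.
\<close>

lemma hit_ever_dichotomy:
  assumes "\<And>x. hit_ever K a x = 1" and "hit_ever K t a \<noteq> 0"
  shows "hit_ever K t x = 1"
proof -
  let ?h = "hit_ever K t" and ?c = "hit_ever K t a"
  have ge: "?c \<le> ?h x" for x
    using superharmonic_ge_hit_ever[of a K ?h x, OF hit_ever_superharmonic] assms(1) by simp
  have c1: "?c \<le> 1" by (rule hit_ever_le_1)
  \<comment> \<open>Truncated form of \<open>h - c \<ge> (1 - c) h\<close>, free of subtraction on the side of \<open>h\<close>.\<close>
  have "?c + (1 - ?c) * hit_within K t n x \<le> ?h x" for n x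
  proof (induction n arbitrary: x)
    case 0
    then show ?case using ge c1 by (auto simp: add_diff_inverse_ennreal)
  next
    case (Suc n)
    show ?case
    proof (cases "x = t")
      case True
      then show ?thesis using c1 by (simp add: add_diff_inverse_ennreal)
    next
      case False
      then have "?c + (1 - ?c) * hit_within K t (Suc n) x
          = (\<integral>\<^sup>+z. ?c + (1 - ?c) * hit_within K t n z \<partial>measure_pmf (K x))"
        by (simp add: nn_integral_add nn_integral_cmult)
      also have "\<dots> \<le> (\<integral>\<^sup>+z. ?h z \<partial>measure_pmf (K x))"
        by (intro nn_integral_mono Suc)
      also have "\<dots> = ?h x"
        using False by (simp add: hit_ever_step)
      finally show ?thesis .
    qed
  qed
  then have "(SUP n. c + (1 - c) * hit_within K t n a) \<le> c" if "c = ?c" for c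
    using that by (auto intro: SUP_least)
  moreover have "(SUP n. c + (1 - c) * hit_within K t n a) = c + (1 - c) * hit_ever K t a" for c
    by (simp add: hit_ever_def SUP_mult_left_ennreal ennreal_SUP_add_right)
  ultimately have "?c + (1 - ?c) * ?c \<le> ?c"
    by metis
  moreover have "?c < \<top>" using c1 by (auto intro: le_less_trans)
  ultimately have "(1 - ?c) * ?c = 0"
    by (metis add.right_neutral ennreal_add_left_cancel_le le_zero_eq infinity_ennreal_def less_irrefl)
  with assms(2) have "1 - ?c = 0" by simp
  then have "1 \<le> ?c" by (simp add: diff_eq_0_iff_ennreal)
  with ge[of x] hit_ever_le_1[of K t x] show ?thesis by (meson antisym order_trans)
qed

lemma nstep_first: "nstep K (Suc n) x = bind_pmf (K x) (nstep K n)"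
proof (induction n)
  case (Suc n)
  have "nstep K (Suc (Suc n)) x = bind_pmf (bind_pmf (K x) (nstep K n)) K"
    using Suc by simp
  also have "\<dots> = bind_pmf (K x) (nstep K (Suc n))"
    by (auto simp: bind_assoc_pmf intro!: bind_pmf_cong)
  finally show ?case .
qed (simp add: bind_return_pmf bind_return_pmf')

lemma nstep_le_hit_within: "ennreal (pmf (nstep K n x) a) \<le> hit_within K a n x"
proof (induction n arbitrary: x)
  case (Suc n)
  show ?case
  proof (cases "x = a")
    case False
    then show ?thesis
      by (simp del: nstep.simps add: nstep_first ennreal_pmf_bind) (intro nn_integral_mono Suc)
  qed (simp add: pmf_le_1)
qed (auto simp: pmf_return)

lemma nstep_le_hit_ever: "ennreal (pmf (nstep K n x) a) \<le> hit_ever K a x"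
  by (rule order_trans[OF nstep_le_hit_within hit_within_le_hit_ever])

text \<open>
  The expected number \<open>G x\<close> of visits to \<open>a\<close> is superharmonic, hence at least \<open>G a\<close> everywhere; counting
  the visit at time 0 gives \<open>G a \<ge> 1 + G a\<close>.
\<close>

lemma expected_visits_infinite:
  assumes "\<And>x. hit_ever K a x = 1"
  shows "(\<Sum>n. ennreal (pmf (nstep K n x) a)) = \<infinity>"
proof -
  define G where "G x = (\<Sum>n. ennreal (pmf (nstep K n x) a))" for x
  have step: "G x = ennreal (pmf (return_pmf x) a) + (\<integral>\<^sup>+z. G z \<partial>measure_pmf (K x))" for x
  proof -
    have "G x = (\<Sum>n. ennreal (pmf (nstep K (Suc n) x) a)) + ennreal (pmf (return_pmf x) a)"
      unfolding G_def by (subst suminf_offset[where i = 1]) (auto simp del: nstep.simps(2))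
    also have "(\<Sum>n. ennreal (pmf (nstep K (Suc n) x) a)) = (\<integral>\<^sup>+z. G z \<partial>measure_pmf (K x))"
      unfolding G_def
      by (simp del: nstep.simps add: nstep_first ennreal_pmf_bind nn_integral_suminf)
    finally show ?thesis by (simp add: add.commute)
  qed
  have ge: "G a \<le> G x" for x
  proof -
    have "(\<integral>\<^sup>+z. G z \<partial>measure_pmf (K x)) \<le> G x" for x
      by (rule order_trans[OF _ eq_refl[OF step[symmetric]]]) simp
    then show ?thesis
      using superharmonic_ge_hit_ever[of a K G x] assms by simp
  qed
  have "1 + G a = 1 + (\<integral>\<^sup>+z. G a \<partial>measure_pmf (K a))"
    by simp
  also have "\<dots> \<le> 1 + (\<integral>\<^sup>+z. G z \<partial>measure_pmf (K a))"
    by (intro add_left_mono nn_integral_mono ge)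
  also have "\<dots> = G a"
    using step[of a] by simp
  finally have "1 + G a \<le> G a" .
  then have "G a = \<infinity>"
    by (metis add.commute add.right_neutral ennreal_add_left_cancel_le not_one_le_zero)
  with ge[of x] show ?thesis by (simp add: G_def top_unique)
qed

section \<open>Excessive measures of a recurrent chain\<close>

text \<open>
  The row vector \<open>\<mu> P\<close>. A measure is \<^emph>\<open>excessive\<close> if \<open>push K \<mu> \<le> \<mu>\<close> pointwise.
\<close>

definition push :: "('s \<Rightarrow> 's pmf) \<Rightarrow> ('s \<Rightarrow> ennreal) \<Rightarrow> 's \<Rightarrow> ennreal" where
  "push K \<mu> y = (\<integral>\<^sup>+x. \<mu> x * pmf (K x) y \<partial>count_space UNIV)"

lemma nn_integral_count_space_swap:
  "(\<integral>\<^sup>+x. \<integral>\<^sup>+y. f x y \<partial>count_space UNIV \<partial>count_space UNIV)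
    = (\<integral>\<^sup>+y. \<integral>\<^sup>+x. f x y \<partial>count_space UNIV \<partial>count_space UNIV)"
  using nn_integral_fst_count_space[of "\<lambda>(x, y). f x y"]
    nn_integral_snd_count_space[of "\<lambda>(x, y). f x y"]
  by simp

lemma push_nstep:
  "(\<integral>\<^sup>+x. push K \<mu> x * pmf (nstep K n x) a \<partial>count_space UNIV)
    = (\<integral>\<^sup>+x. \<mu> x * pmf (nstep K (Suc n) x) a \<partial>count_space UNIV)"
proof -
  have "(\<integral>\<^sup>+x. push K \<mu> x * pmf (nstep K n x) a \<partial>count_space UNIV)
    = (\<integral>\<^sup>+x. \<integral>\<^sup>+w. \<mu> w * pmf (K w) x * pmf (nstep K n x) a \<partial>count_space UNIV \<partial>count_space UNIV)"
    by (simp add: push_def nn_integral_multc)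
  also have "\<dots> = (\<integral>\<^sup>+w. \<integral>\<^sup>+x. \<mu> w * pmf (K w) x * pmf (nstep K n x) a \<partial>count_space UNIV \<partial>count_space UNIV)"
    by (rule nn_integral_count_space_swap)
  also have "\<dots> = (\<integral>\<^sup>+x. \<mu> x * pmf (nstep K (Suc n) x) a \<partial>count_space UNIV)"
    by (simp del: nstep.simps add: nstep_first ennreal_pmf_bind nn_integral_measure_pmf
        nn_integral_cmult mult.assoc)
  finally show ?thesis .
qed

lemma nn_integral_nstep_0:
  fixes \<mu> :: "'s \<Rightarrow> ennreal"
  shows "(\<integral>\<^sup>+x. \<mu> x * pmf (nstep K 0 x) a \<partial>count_space UNIV) = \<mu> a"
proof -
  have "(\<integral>\<^sup>+x. \<mu> x * pmf (nstep K 0 x) a \<partial>count_space UNIV)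
    = (\<integral>\<^sup>+x. \<mu> a * indicator {a} x \<partial>count_space UNIV)"
    by (intro nn_integral_cong) (auto simp: indicator_def)
  then show ?thesis by (simp add: nn_integral_cmult_indicator)
qed

lemma push_mono: "(\<And>x. \<mu> x \<le> \<mu>' x) \<Longrightarrow> push K \<mu> y \<le> push K \<mu>' y"
  unfolding push_def by (intro nn_integral_mono mult_right_mono) auto

lemma push_add: "push K (\<lambda>x. \<mu> x + \<mu>' x) y = push K \<mu> y + push K \<mu>' y"
  unfolding push_def by (simp add: distrib_right nn_integral_add)

lemma push_cmult: "push K (\<lambda>x. c * \<mu> x) y = c * push K \<mu> y"
  unfolding push_def by (simp add: mult.assoc nn_integral_cmult)

lemma excessive_eq_0:
  assumes "\<And>x. hit_ever K a x = 1" and exc: "\<And>y. push K m y \<le> m y" and "m a = 0"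
  shows "m x = 0"
proof -
  have le: "(\<integral>\<^sup>+x. m x * pmf (nstep K n x) a \<partial>count_space UNIV) \<le> m a" for n
  proof (induction n)
    case 0
    show ?case by (simp only: nn_integral_nstep_0 sum.empty lessThan_0 add_0 order_refl)
  next
    case (Suc n)
    have "(\<integral>\<^sup>+x. m x * pmf (nstep K (Suc n) x) a \<partial>count_space UNIV)
      \<le> (\<integral>\<^sup>+x. m x * pmf (nstep K n x) a \<partial>count_space UNIV)"
      unfolding push_nstep[symmetric] by (intro nn_integral_mono mult_right_mono exc) auto
    with Suc show ?case by (rule order_trans[rotated])
  qed
  have "m x * pmf (nstep K n x) a = 0" for n
    using le[of n] \<open>m a = 0\<close> by (simp add: nn_integral_0_iff_AE AE_count_space)
  moreover have "\<exists>n. ennreal (pmf (nstep K n x) a) \<noteq> 0"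
  proof (rule ccontr)
    assume "\<nexists>n. ennreal (pmf (nstep K n x) a) \<noteq> 0"
    then have "(\<Sum>n. ennreal (pmf (nstep K n x) a)) = 0" by simp
    with expected_visits_infinite[OF assms(1)] show False by simp
  qed
  ultimately show ?thesis by auto
qed

text \<open>
  If \<open>g = m - m P\<close>, iteration gives \<open>m = \<Sum>n<N. g P^n + m P^N\<close>. At \<open>a\<close> the sum of \<open>g x P^n(x, a)\<close> over all
  \<open>n\<close> is infinite as soon as \<open>g x\<close> is positive, whereas \<open>m a\<close> is finite.
\<close>

lemma excessive_imp_invariant:
  assumes h: "\<And>x. hit_ever K a x = 1" and exc: "\<And>y. push K m y \<le> m y"
    and fin: "m a < \<infinity>"
  shows "push K m y = m y"
proof -
  define g where "g y = m y - push K m y" for y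
  have m: "m y = push K m y + g y" for y
    using exc[of y] by (simp add: g_def add_diff_inverse_ennreal)
  have eq: "m a = (\<Sum>n<N. \<integral>\<^sup>+x. g x * pmf (nstep K n x) a \<partial>count_space UNIV)
      + (\<integral>\<^sup>+x. m x * pmf (nstep K N x) a \<partial>count_space UNIV)" for N
  proof (induction N)
    case 0
    show ?case by (simp only: nn_integral_nstep_0 sum.empty lessThan_0 add_0 order_refl)
  next
    case (Suc N)
    have "(\<integral>\<^sup>+x. m x * pmf (nstep K N x) a \<partial>count_space UNIV)
      = (\<integral>\<^sup>+x. push K m x * pmf (nstep K N x) a + g x * pmf (nstep K N x) a \<partial>count_space UNIV)"
      by (subst m) (simp add: distrib_right)
    also have "\<dots> = (\<integral>\<^sup>+x. m x * pmf (nstep K (Suc N) x) a \<partial>count_space UNIV)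
       + (\<integral>\<^sup>+x. g x * pmf (nstep K N x) a \<partial>count_space UNIV)"
      by (simp add: nn_integral_add push_nstep del: nstep.simps)
    finally show ?case using Suc by (simp add: ac_simps del: nstep.simps)
  qed
  have "(\<Sum>n<N. \<integral>\<^sup>+x. g x * pmf (nstep K n x) a \<partial>count_space UNIV) \<le> m a" for N
    by (subst eq[of N]) simp
  then have "(\<Sum>n. \<integral>\<^sup>+x. g x * pmf (nstep K n x) a \<partial>count_space UNIV) \<le> m a"
    by (simp add: suminf_eq_SUP SUP_least)
  also have "(\<Sum>n. \<integral>\<^sup>+x. g x * pmf (nstep K n x) a \<partial>count_space UNIV)
     = (\<integral>\<^sup>+x. (\<Sum>n. g x * pmf (nstep K n x) a) \<partial>count_space UNIV)"
    by (rule nn_integral_suminf[symmetric]) auto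
  also have "\<dots> = (\<integral>\<^sup>+x. g x * \<infinity> \<partial>count_space UNIV)"
    by (simp add: expected_visits_infinite[OF h])
  finally have "(\<integral>\<^sup>+x. g x * \<infinity> \<partial>count_space UNIV) < \<infinity>"
    using fin by (rule le_less_trans)
  then have "AE x in count_space UNIV. g x * \<infinity> \<noteq> \<infinity>"
    by (intro nn_integral_noteq_infinite) auto
  then have "g y = 0"
    by (auto simp: AE_count_space ennreal_mult_eq_top_iff)
  then show ?thesis using m[of y] by simp
qed

text \<open>
  Excessive measures are thus as rigid as invariant ones, with the advantage of being stable under
  pointwise minimum. Comparing \<open>m\<close> and \<open>m'\<close> with their minimum reduces the claim to \<open>m \<le> m'\<close>; then
  \<open>m' - m\<close> is an excessive measure that vanishes at \<open>a\<close>.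
\<close>

lemma excessive_eqI:
  assumes h: "\<And>x. hit_ever K a x = 1"
    and "\<And>y. push K m y \<le> m y" "\<And>y. push K m' y \<le> m' y"
    and "\<And>y. m y < \<infinity>" "\<And>y. m' y < \<infinity>" "m a = m' a"
  shows "m = m'"
proof -
  have below: "k = l" if k: "\<And>y. push K k y \<le> k y" and l: "\<And>y. push K l y \<le> l y"
    and fin: "\<And>y. l y < \<infinity>" and le: "\<And>y. k y \<le> l y" and eq: "k a = l a" for k l
  proof
    fix x
    define d where "d y = l y - k y" for y
    have ld: "l y = k y + d y" for y
      using le[of y] by (simp add: d_def add_diff_inverse_ennreal)
    have fin': "k y < \<infinity>" for y
      using le[of y] fin[of y] by (rule le_less_trans)
    have "push K d y \<le> d y" for y
    proof -
      have "l = (\<lambda>y. k y + d y)"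
        using ld by blast
      then have "k y + d y = push K (\<lambda>y. k y + d y) y"
        using excessive_imp_invariant[OF h l fin, of y] by simp
      also have "\<dots> = k y + push K d y"
        using excessive_imp_invariant[OF h k fin', of y] by (simp add: push_add)
      finally show ?thesis using fin'[of y] by (auto simp: ennreal_add_left_cancel)
    qed
    moreover have "d a = 0"
      using eq fin[of a] by (simp add: d_def)
    ultimately have "d x = 0"
      by (rule excessive_eq_0[OF h])
    then show "k x = l x" using ld[of x] by simp
  qed
  let ?min = "\<lambda>y. min (m y) (m' y)"
  have "push K ?min y \<le> ?min y" for y
    using push_mono[of ?min m K y] push_mono[of ?min m' K y] assms(2,3)[of y] by auto
  then have "?min = m" "?min = m'"
    using assms by (auto intro!: below)
  then show ?thesis by simp
qed

text \<open>
  One state \<open>a\<close> that is hit from everywhere with probability 1 makes the chain recurrent on the support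
  of any invariant measure charging \<open>a\<close>. Uniqueness is \<open>excessive_eqI\<close> after scaling. For the support, let
  \<open>R\<close> be the set of states that can be reached from \<open>a\<close>: since \<open>R\<close> is closed, the restriction of
  \<open>\<nu>\<close> to \<open>R\<close> is excessive, and it agrees with \<open>\<nu>\<close> at \<open>a\<close>, so it is \<open>\<nu>\<close> and every state charged by \<open>\<nu>\<close>
  lies in \<open>R\<close>. The zero-one law does the rest.
\<close>

lemma recurrence_from_one_state:
  assumes h: "\<And>x. hit_ever K a x = 1" and inv: "invariant_measure K \<nu>" and a: "\<nu> a \<noteq> 0"
  shows invariant_measure_unique: "invariant_measure K \<mu> \<Longrightarrow> \<mu> = (\<lambda>x. \<mu> a / \<nu> a * \<nu> x)"
    and hit_ever_support: "\<nu> t \<noteq> 0 \<Longrightarrow> hit_ever K t x = 1"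
proof -
  have push: "push K \<mu> y = \<mu> y" "\<mu> y < \<infinity>" if "invariant_measure K \<mu>" for \<mu> y
    using that by (auto simp: invariant_measure_def push_def)
  show "\<mu> = (\<lambda>x. \<mu> a / \<nu> a * \<nu> x)" if \<mu>: "invariant_measure K \<mu>"
  proof (rule excessive_eqI[OF h])
    have "\<mu> a / \<nu> a < \<infinity>"
      using push(2)[OF \<mu>, of a] a ennreal_divide_eq_top_iff[of "\<mu> a" "\<nu> a"]
      by (metis infinity_ennreal_def less_irrefl top.not_eq_extremum)
    then show "\<mu> a / \<nu> a * \<nu> y < \<infinity>" for y
      using push(2)[OF inv, of y] by (simp add: ennreal_mult_less_top)
    show "\<mu> a = \<mu> a / \<nu> a * \<nu> a"
      using a push(2)[OF inv, of a]
      by (simp add: ennreal_divide_times ennreal_divide_self)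
  qed (simp_all add: push_cmult push[OF \<mu>, simplified] push[OF inv])
  show "hit_ever K t x = 1" if t: "\<nu> t \<noteq> 0"
  proof (rule hit_ever_dichotomy[OF h])
    define R where "R = {s. \<exists>n. pmf (nstep K n a) s > 0}"
    have closed: "s' \<in> R" if "s \<in> R" "pmf (K s) s' \<noteq> 0" for s s'
    proof -
      from that obtain n where "s \<in> set_pmf (nstep K n a)" "s' \<in> set_pmf (K s)"
        by (auto simp: R_def set_pmf_iff dest!: less_imp_neq[THEN not_sym])
      then have "s' \<in> set_pmf (nstep K (Suc n) a)"
        by (auto simp: set_bind_pmf)
      then show ?thesis
        unfolding R_def mem_Collect_eq by (blast intro: pmf_positive)
    qed
    have "a \<in> R"
      by (auto simp: R_def intro!: exI[of _ 0])
    let ?m = "\<lambda>s. if s \<in> R then \<nu> s else 0"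
    have exc: "push K ?m y \<le> ?m y" for y
    proof (cases "y \<in> R")
      case True
      then show ?thesis
        using push_mono[of ?m \<nu> K y] push(1)[OF inv, of y] by simp
    next
      case False
      then have "?m s * ennreal (pmf (K s) y) = 0" for s
        using closed[of s y] by (cases "pmf (K s) y = 0") auto
      then have "push K ?m y = 0"
        unfolding push_def by (simp only: nn_integral_const) simp
      then show ?thesis by simp
    qed
    have m: "?m = \<nu>"
    proof (rule excessive_eqI[OF h])
      show "push K ?m y \<le> ?m y" for y
        by (rule exc)
      show "?m s < \<infinity>" for s
        using push(2)[OF inv, of s] by simp
    qed (simp_all add: push[OF inv, simplified] \<open>a \<in> R\<close>)
    have "t \<in> R"
      using t fun_cong[OF m, of t] by (auto split: if_splits)
    then obtain n where "0 < ennreal (pmf (nstep K n a) t)"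
      by (auto simp: R_def)
    then show "hit_ever K t a \<noteq> 0"
      using nstep_le_hit_ever[of K n a t] by auto
  qed
qed

section \<open>The law of the trajectories\<close>

abbreviation traj_space :: "(nat \<Rightarrow> 's) measure" where
  "traj_space \<equiv> PiM UNIV (\<lambda>_. count_space UNIV)"

lemma sets_paths [measurable_cong]: "sets (paths K x) = sets traj_space"
proof -
  interpret IT: Ionescu_Tulcea "step_kernel K x" "\<lambda>_. count_space UNIV"
    by (rule Ionescu_Tulcea_step_kernel)
  show ?thesis by (simp add: paths_def)
qed

lemma space_paths [simp]: "space (paths K x) = UNIV"
  using sets_eq_imp_space_eq[OF sets_paths[of K x]] by (simp add: space_PiM)

lemma prob_space_paths: "prob_space (paths K x)"
proof -
  interpret IT: Ionescu_Tulcea "step_kernel K x" "\<lambda>_. count_space UNIV"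
    by (rule Ionescu_Tulcea_step_kernel)
  show ?thesis
  proof (rule prob_spaceI)
    let ?A = "PiE {0..<1} (\<lambda>_. UNIV) :: (nat \<Rightarrow> 'a) set"
    have "emeasure (paths K x) (space (paths K x)) 
      = emeasure IT.PF.lim (prod_emb UNIV (\<lambda>_. count_space UNIV) {0..<1} (space (PiM {0..<1} (\<lambda>_. count_space UNIV))))"
      by (auto simp: paths_def prod_emb_def space_PiM PiE_UNIV_domain intro!: arg_cong[where f = "emeasure _"])
    also have "\<dots> = emeasure (IT.CI {0..<1}) (space (PiM {0..<1} (\<lambda>_. count_space UNIV)))"
      by (rule IT.lim) auto
    also have "\<dots> = 1"
      using prob_space.emeasure_space_1[OF IT.PF.prob_space_P[of "{0..<1}"]]
      sets_eq_imp_space_eq[OF IT.PF.sets_P[of "{0..<1}"]] by simp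
    finally show "emeasure (paths K x) (space (paths K x)) = 1" .
  qed
qed

abbreviation cylinder :: "nat \<Rightarrow> (nat \<Rightarrow> 's) \<Rightarrow> (nat \<Rightarrow> 's) set" where
  "cylinder n s \<equiv> {\<omega>. \<forall>i\<le>n. \<omega> i = s i}"

lemma cylinder_measurable [measurable]: "cylinder n s \<in> sets traj_space"
proof -
  have "{\<omega> \<in> space traj_space. \<forall>i\<le>n. \<omega> i = s i} \<in> sets traj_space"
    by measurable
  then show ?thesis by (simp add: space_PiM)
qed

text \<open>
  Cylinders fix finitely many initial coordinates completely; countability of the state space is what
  makes them generate the product \<open>\<sigma>\<close>-algebra.
\<close>

lemma sets_traj_space_cylinders:
  "sets (traj_space :: (nat \<Rightarrow> 's::countable) measure)
    = sigma_sets UNIV (insert {} {cylinder n s | n s. True})" (is "_ = sigma_sets _ ?E")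
proof
  have "?E \<subseteq> sets traj_space"
    using cylinder_measurable by blast
  from sets.sigma_sets_subset[OF this]
  show "sigma_sets UNIV ?E \<subseteq> sets (traj_space :: (nat \<Rightarrow> 's) measure)"
    by (simp add: space_PiM)
  have "{\<omega>. \<omega> i \<in> A} \<in> sigma_sets UNIV ?E" for i and A :: "'s set"
  proof -
    interpret sigma_algebra UNIV "sigma_sets UNIV ?E"
      by (rule sigma_algebra_sigma_sets) auto
    \<comment> \<open>The finite initial segments are listed as words, of which there are countably many.\<close>
    have "{\<omega>. \<omega> i \<in> A} = (\<Union>l\<in>{l. length l = Suc i \<and> l ! i \<in> A}. cylinder i ((!) l))"
    proof (intro equalityI subsetI)
      fix \<omega> assume "\<omega> \<in> {\<omega>. \<omega> i \<in> A}"
      then have "\<omega> \<in> cylinder i ((!) (map \<omega> [0..<Suc i]))" "length (map \<omega> [0..<Suc i]) = Suc i"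
         "map \<omega> [0..<Suc i] ! i \<in> A"
        by (auto simp del: upt_Suc simp: nth_map)
      then show "\<omega> \<in> (\<Union>l\<in>{l. length l = Suc i \<and> l ! i \<in> A}. cylinder i ((!) l))"
        by blast
    qed auto
    also have "\<dots> \<in> sigma_sets UNIV ?E"
      by (intro countable_UN'') (auto intro: sigma_sets.Basic)
    finally show ?thesis .
  qed
  then show "sets (traj_space :: (nat \<Rightarrow> 's) measure) \<subseteq> sigma_sets UNIV ?E"
    by (simp add: sets_PiM_single PiE_UNIV_domain, intro sigma_sets_mono) auto
qed

lemma measure_eqI_cylinders:
  fixes M N :: "(nat \<Rightarrow> 's::countable) measure"
  assumes "sets M = sets traj_space" "sets N = sets traj_space"
    and eq: "\<And>n s. emeasure M (cylinder n s) = emeasure N (cylinder n s)"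
    and fin: "\<And>n s. emeasure M (cylinder n s) \<noteq> \<infinity>"
  shows "M = N"
proof (rule measure_eqI_generator_eq_countable)
  let ?E = "insert {} {cylinder n s | n s. True} :: (nat \<Rightarrow> 's) set set"
  show "Int_stable ?E"
  proof (rule Int_stableI)
    have *: "cylinder n s \<inter> cylinder m t \<in> ?E" if "n \<le> m" for n m and s t :: "nat \<Rightarrow> 's"
    proof (cases "\<forall>i\<le>n. s i = t i")
      case True
      with that have "cylinder n s \<inter> cylinder m t = cylinder m t"
        by auto
      then show ?thesis by blast
    next
      case False
      with that have "cylinder n s \<inter> cylinder m t = {}"
        by auto
      then show ?thesis by blast
    qed
    show "A \<inter> B \<in> ?E" if AB: "A \<in> ?E" "B \<in> ?E" for A B
    proof (cases "A = {} \<or> B = {}")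
      case False
      with AB obtain n s m t where "A = cylinder n s" "B = cylinder m t"
        by auto
      then show ?thesis
        using *[of n m s t] *[of m n t s] nat_le_linear[of n m] by (auto simp only: Int_commute)
    qed auto
  qed
  show "sets M = sigma_sets UNIV ?E" "sets N = sigma_sets UNIV ?E"
    using assms(1,2) by (simp_all add: sets_traj_space_cylinders)
  show "range (\<lambda>a. cylinder 0 (\<lambda>_. a)) \<subseteq> ?E"
    by auto
  show "\<Union> (range (\<lambda>a. cylinder 0 (\<lambda>_. a))) = (UNIV :: (nat \<Rightarrow> 's) set)"
    by auto
  show "emeasure M A = emeasure N A" if "A \<in> ?E" for A
    using that eq by auto
  show "emeasure M A \<noteq> \<infinity>" if A: "A \<in> range (\<lambda>a. cylinder 0 (\<lambda>_. a))" for A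
  proof -
    from A obtain a where "A = cylinder 0 (\<lambda>_. a)"
      by (rule rangeE)
    with fin[of 0 "\<lambda>_. a"] show ?thesis by simp
  qed
qed auto

lemma shifted_paths_subprob [simp]:
  "distr (paths K z) traj_space (case_nat x) \<in> space (subprob_algebra traj_space)"
proof -
  have "case_nat x \<in> measurable (paths K z) traj_space"
    by measurable
  then show ?thesis
    by (simp add: space_subprob_algebra prob_space_imp_subprob_space prob_space.prob_space_distr
        prob_space_paths)
qed

text \<open>
  The Markov property at time 1: both sides give the same mass to every cylinder.
\<close>

lemma paths_first_step:
  fixes K :: "'s::countable \<Rightarrow> 's pmf"
  shows "paths K x = measure_pmf (K x) \<bind> (\<lambda>z. distr (paths K z) traj_space (case_nat x))"
proof (rule measure_eqI_cylinders)
  show "sets (paths K x) = sets traj_space" by (rule sets_paths)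
  show "sets (measure_pmf (K x) \<bind> (\<lambda>z. distr (paths K z) traj_space (case_nat x))) = sets traj_space"
    by (rule sets_bind) auto
  show "emeasure (paths K x) (cylinder n s) \<noteq> \<infinity>" for n s
    by (simp add: emeasure_paths_cylinder)
  fix n and s :: "nat \<Rightarrow> 's"
  have "emeasure (measure_pmf (K x) \<bind> (\<lambda>z. distr (paths K z) traj_space (case_nat x))) (cylinder n s)
    = (\<integral>\<^sup>+z. emeasure (paths K z) (case_nat x -` cylinder n s) \<partial>measure_pmf (K x))"
    by (subst emeasure_bind[where N = traj_space]) (auto simp: emeasure_distr)
  also have "\<dots> = emeasure (paths K x) (cylinder n s)"
  proof (cases n)
    case 0
    have "case_nat x -` cylinder 0 s = (if s 0 = x then UNIV else {})"
      by auto
    then show ?thesis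
      using prob_space.emeasure_space_1[OF prob_space_paths, of K] 0
      by (auto simp: emeasure_paths_cylinder[where n = 0, simplified])
  next
    case (Suc m)
    have "(\<forall>i\<le>Suc m. case_nat x \<omega> i = s i) \<longleftrightarrow> s 0 = x \<and> (\<forall>i\<le>m. \<omega> i = s (Suc i))" for \<omega>
      unfolding less_Suc_eq_le[symmetric] All_less_Suc2 by auto
    then have "case_nat x -` cylinder n s = (if s 0 = x then cylinder m (\<lambda>i. s (Suc i)) else {})"
      using Suc by auto
    have "(\<integral>\<^sup>+z. emeasure (paths K z) (cylinder m (\<lambda>i. s (Suc i))) \<partial>measure_pmf (K x))
       = (\<integral>\<^sup>+z. ennreal (\<Prod>i<m. pmf (K (s (Suc i))) (s (Suc (Suc i)))) * indicator {s 1} z \<partial>measure_pmf (K x))"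
      by (intro nn_integral_cong) (auto simp: emeasure_paths_cylinder)
    also have "\<dots> = ennreal (\<Prod>i<m. pmf (K (s (Suc i))) (s (Suc (Suc i)))) * pmf (K x) (s 1)"
      by (simp add: nn_integral_cmult_indicator emeasure_pmf_single)
    finally show ?thesis
      using Suc \<open>case_nat x -` cylinder n s = _\<close>
      by (simp add: emeasure_paths_cylinder prod.lessThan_Suc_shift ennreal_mult prod_nonneg mult.commute
          del: prod.lessThan_Suc)
  qed
  finally show "emeasure (paths K x) (cylinder n s)
    = emeasure (measure_pmf (K x) \<bind> (\<lambda>z. distr (paths K z) traj_space (case_nat x))) (cylinder n s)" ..
qed

lemma nn_integral_paths_first_step:
  fixes K :: "'s::countable \<Rightarrow> 's pmf"
  assumes [measurable]: "f \<in> borel_measurable traj_space"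
  shows "(\<integral>\<^sup>+\<omega>. f \<omega> \<partial>paths K x) = (\<integral>\<^sup>+z. \<integral>\<^sup>+\<omega>. f (case_nat x \<omega>) \<partial>paths K z \<partial>measure_pmf (K x))"
proof -
  have "(\<integral>\<^sup>+\<omega>. f \<omega> \<partial>paths K x)
     = (\<integral>\<^sup>+z. \<integral>\<^sup>+\<omega>. f \<omega> \<partial>distr (paths K z) traj_space (case_nat x) \<partial>measure_pmf (K x))"
    by (subst paths_first_step, rule nn_integral_bind[where B = traj_space]) simp_all
  also have "\<dots> = (\<integral>\<^sup>+z. \<integral>\<^sup>+\<omega>. f (case_nat x \<omega>) \<partial>paths K z \<partial>measure_pmf (K x))"
    by (intro nn_integral_cong nn_integral_distr) measurable
  finally show ?thesis .
qed

lemma AE_paths_first_step: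
  fixes K :: "'s::countable \<Rightarrow> 's pmf"
  assumes [measurable]: "Measurable.pred traj_space P"
  shows "(AE \<omega> in paths K x. P \<omega>) \<longleftrightarrow> (AE z in K x. AE \<omega> in paths K z. P (case_nat x \<omega>))"
proof -
  have "(AE \<omega> in paths K x. P \<omega>)
     \<longleftrightarrow> (AE z in K x. AE \<omega> in distr (paths K z) traj_space (case_nat x). P \<omega>)"
    by (subst paths_first_step, rule AE_bind[where B = traj_space]) simp_all
  also have "\<dots> \<longleftrightarrow> (AE z in K x. AE \<omega> in paths K z. P (case_nat x \<omega>))"
    by (subst AE_distr_iff) measurable
  finally show ?thesis .
qed

lemma AE_paths_start:
  fixes K :: "'s::countable \<Rightarrow> 's pmf"
  shows "AE \<omega> in paths K x. \<omega> 0 = x"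
proof -
  have "AE z in K x. AE \<omega> in paths K z. case_nat x \<omega> 0 = x"
    by simp
  then show ?thesis
    by (subst AE_paths_first_step) simp_all
qed

lemma emeasure_paths_hit_within:
  fixes K :: "'s::countable \<Rightarrow> 's pmf"
  shows "emeasure (paths K x) {\<omega>. \<exists>n\<le>N. \<omega> n = a} = hit_within K a N x"
proof -
  interpret P: prob_space "paths K z" for z by (rule prob_space_paths)
  have [measurable]: "{\<omega>. \<exists>n\<le>N. \<omega> n = a} \<in> sets traj_space" for N
  proof -
    have "{\<omega> \<in> space traj_space. \<exists>n\<le>N. \<omega> n = a} \<in> sets traj_space"
      by measurable
    then show ?thesis by (simp add: space_PiM)
  qed
  have "(\<integral>\<^sup>+\<omega>. indicator {\<omega>. \<exists>n\<le>N. \<omega> n = a} \<omega> \<partial>paths K x) = hit_within K a N x"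
  proof (induction N arbitrary: x)
    case 0
    have "{\<omega>. \<exists>n\<le>0. \<omega> n = a} = cylinder 0 (\<lambda>_. a)" by auto
    then have "(\<integral>\<^sup>+\<omega>. indicator {\<omega>. \<exists>n\<le>0. \<omega> n = a} \<omega> \<partial>paths K x) = emeasure (paths K x) (cylinder 0 (\<lambda>_. a))"
      by (simp only: nn_integral_indicator sets_paths cylinder_measurable)
    then show ?case
      by (simp only: emeasure_paths_cylinder) auto
  next
    case (Suc N)
    have "(\<exists>n\<le>Suc N. case_nat x \<omega> n = a) \<longleftrightarrow> x = a \<or> (\<exists>n\<le>N. \<omega> n = a)" for \<omega>
      unfolding less_Suc_eq_le[symmetric] Ex_less_Suc2 by auto
    then have *: "indicator {\<omega>. \<exists>n\<le>Suc N. \<omega> n = a} (case_nat x \<omega>)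
      = (if x = a then 1 else indicator {\<omega>. \<exists>n\<le>N. \<omega> n = a} \<omega> :: ennreal)" for \<omega>
      by (auto simp: indicator_def)
    show ?case
      by (subst nn_integral_paths_first_step) (auto simp: * Suc P.emeasure_space_1[simplified])
  qed
  then show ?thesis
    by (subst (asm) nn_integral_indicator) (simp_all add: sets_paths)
qed

lemma emeasure_paths_hit_ever:
  fixes K :: "'s::countable \<Rightarrow> 's pmf"
  shows "emeasure (paths K x) {\<omega>. \<exists>n. \<omega> n = a} = hit_ever K a x"
proof -
  have "{\<omega> \<in> space traj_space. \<exists>n\<le>N. \<omega> n = a} \<in> sets traj_space" for N
    by measurable
  then have "(SUP N. emeasure (paths K x) {\<omega>. \<exists>n\<le>N. \<omega> n = a}) 
     = emeasure (paths K x) (\<Union>N. {\<omega>. \<exists>n\<le>N. \<omega> n = a})"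
    by (intro SUP_emeasure_incseq) (auto simp: incseq_def sets_paths space_PiM intro: order_trans)
  also have "(\<Union>N::nat. {\<omega>. \<exists>n\<le>N. \<omega> n = a}) = {\<omega>. \<exists>n. \<omega> n = a}"
  proof (intro equalityI subsetI)
    fix \<omega> :: "nat \<Rightarrow> 's" assume "\<omega> \<in> {\<omega>. \<exists>n. \<omega> n = a}"
    then obtain N :: nat where "\<omega> N = a" by auto
    then have "\<omega> \<in> {\<omega>. \<exists>n\<le>N. \<omega> n = a}" by auto
    then show "\<omega> \<in> (\<Union>N. {\<omega>. \<exists>n\<le>N. \<omega> n = a})" by blast
  qed auto
  finally show ?thesis by (simp add: emeasure_paths_hit_within hit_ever_def)
qed

lemma AE_hit_iff:
  fixes K :: "'s::countable \<Rightarrow> 's pmf"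
  shows "(AE \<omega> in paths K x. \<exists>n. \<omega> n = a) \<longleftrightarrow> hit_ever K a x = 1"
proof -
  interpret P: prob_space "paths K x" by (rule prob_space_paths)
  have "{\<omega> \<in> space traj_space. \<exists>n. \<omega> n = a} \<in> sets traj_space"
    by measurable
  then have "{\<omega>. \<exists>n. \<omega> n = a} \<in> P.events"
    by (simp add: sets_paths space_PiM)
  from P.AE_in_set_eq_1[OF this] show ?thesis
    by (simp flip: emeasure_paths_hit_ever add: P.emeasure_eq_measure ennreal_eq_1)
qed

text \<open>
  A visit after time \<open>m\<close> for the chain from \<open>x\<close> is a visit after time \<open>m - 1\<close> for the chain started from the
  first state after \<open>x\<close>, so that visits after any time are almost sure by induction on \<open>m\<close>.
\<close>

lemma AE_infinitely_often:
  fixes K :: "'s::countable \<Rightarrow> 's pmf"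
  assumes h: "\<And>x. hit_ever K a x = 1"
  shows "AE \<omega> in paths K x. \<exists>\<^sub>\<infinity>n. \<omega> n = a"
proof -
  have "AE \<omega> in paths K x. \<exists>n\<ge>m. \<omega> n = a" for m
  proof (induction m arbitrary: x)
    case 0
    then show ?case using h by (simp add: AE_hit_iff)
  next
    case (Suc m)
    have "AE \<omega> in paths K z. \<exists>n\<ge>Suc m. case_nat x \<omega> n = a" for z
      using Suc[of z] by eventually_elim (metis Suc_le_mono old.nat.simps(5))
    then show ?case
      by (subst AE_paths_first_step) auto
  qed
  then show ?thesis
    by (simp add: INFM_nat_le AE_all_countable)
qed

lemma recurrent_withI:
  fixes K :: "'s::countable \<Rightarrow> 's pmf"
  assumes "\<And>x. hit_ever K a x = 1" "invariant_measure K \<nu>" "\<nu> a \<noteq> 0"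
  shows "recurrent_with K \<nu>"
  unfolding recurrent_with_def visits_infinitely_often_def
proof (intro conjI allI impI)
  show "AE \<omega> in paths K x. \<forall>y\<in>{x. \<nu> x \<noteq> 0}. \<exists>\<^sub>\<infinity>n. \<omega> n = y" for x
    by (subst AE_ball_countable)
       (auto intro!: AE_infinitely_often hit_ever_support[OF assms])
  show "\<exists>c. \<mu> = (\<lambda>x. c * \<nu> x)" if "invariant_measure K \<mu>" for \<mu>
    using invariant_measure_unique[OF assms that] by blast
qed fact

section \<open>Irreducible and reversible chains\<close>

lemma invariant_push: "invariant_measure K \<mu> \<Longrightarrow> push K \<mu> y = \<mu> y"
  by (simp add: invariant_measure_def push_def)

lemma invariant_measure_nstep:
  assumes "invariant_measure K \<pi>"
  shows "(\<integral>\<^sup>+x. \<pi> x * pmf (nstep K n x) y \<partial>count_space UNIV) = \<pi> y"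
proof (induction n)
  case 0
  show ?case by (simp only: nn_integral_nstep_0 sum.empty lessThan_0 add_0 order_refl)
next
  case (Suc n)
  then show ?case
    by (simp only: push_nstep[symmetric] invariant_push[OF assms])
qed

lemma irreducible_invariant_pos:
  assumes irr: "irreducible_chain K" and inv: "invariant_measure K \<pi>"
  shows "\<pi> y \<noteq> 0"
proof
  assume 0: "\<pi> y = 0"
  obtain x where x: "\<pi> x \<noteq> 0"
    using inv by (auto simp: invariant_measure_def)
  obtain n where n: "pmf (nstep K n x) y > 0"
    using irr by (auto simp: irreducible_chain_def)
  have "(\<integral>\<^sup>+x. \<pi> x * pmf (nstep K n x) y \<partial>count_space UNIV) = 0"
    using invariant_measure_nstep[OF inv] 0 by simp
  then have "\<pi> x * pmf (nstep K n x) y = 0"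
    by (simp add: nn_integral_0_iff_AE AE_count_space)
  with x n show False by simp
qed

lemma nn_integral_pmf_eq_1D:
  assumes le: "\<And>z. f z \<le> 1" and eq: "(\<integral>\<^sup>+z. f z \<partial>measure_pmf p) = 1" and z: "z \<in> set_pmf p"
  shows "f z = 1"
proof -
  have "(\<integral>\<^sup>+z. 1 - f z \<partial>measure_pmf p) = (\<integral>\<^sup>+z. 1 \<partial>measure_pmf p) - (\<integral>\<^sup>+z. f z \<partial>measure_pmf p)"
    by (rule nn_integral_diff) (auto simp: le eq)
  then have "AE z in measure_pmf p. 1 - f z = 0"
    using eq by (simp add: nn_integral_0_iff_AE)
  with z have "1 - f z = 0"
    by (auto simp: AE_measure_pmf_iff)
  then have "1 \<le> f z"
    by (simp add: diff_eq_0_iff_ennreal)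
  with le[of z] show ?thesis
    by (rule antisym)
qed

text \<open>
  Let \<open>h\<close> be the probability of hitting \<open>a\<close>. Then \<open>P h \<le> h\<close>, and both functions have the same finite
  \<open>\<pi>\<close>-integral; as \<open>\<pi>\<close> is positive everywhere, \<open>P h = h\<close>, at \<open>a\<close> included. So wherever \<open>h\<close> attains its
  maximal value 1, it does so at all successors too, and irreducibility spreads this from \<open>a\<close> to all states.
\<close>

lemma finite_invariant_hit_ever:
  assumes irr: "irreducible_chain K" and inv: "invariant_measure K \<pi>"
    and fin: "total_mass \<pi> < \<infinity>"
  shows "hit_ever K a x = 1"
proof -
  let ?h = "hit_ever K a" and ?Ph = "\<lambda>x. \<integral>\<^sup>+z. hit_ever K a z \<partial>measure_pmf (K x)"
  have int_le: "(\<integral>\<^sup>+x. \<pi> x * ?h x \<partial>count_space UNIV) \<le> total_mass \<pi>"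
    unfolding total_mass_def
    by (intro nn_integral_mono) (metis hit_ever_le_1 mult.right_neutral mult_left_mono zero_le)
  have "(\<integral>\<^sup>+x. \<pi> x * ?Ph x \<partial>count_space UNIV)
    = (\<integral>\<^sup>+x. \<integral>\<^sup>+z. \<pi> x * pmf (K x) z * ?h z \<partial>count_space UNIV \<partial>count_space UNIV)"
    by (simp add: nn_integral_measure_pmf nn_integral_cmult mult.assoc)
  also have "\<dots> = (\<integral>\<^sup>+z. \<integral>\<^sup>+x. \<pi> x * pmf (K x) z * ?h z \<partial>count_space UNIV \<partial>count_space UNIV)"
    by (rule nn_integral_count_space_swap)
  also have "\<dots> = (\<integral>\<^sup>+z. \<pi> z * ?h z \<partial>count_space UNIV)"
    using inv by (simp add: nn_integral_multc invariant_measure_def)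
  finally have eq: "(\<integral>\<^sup>+x. \<pi> x * ?Ph x \<partial>count_space UNIV) = (\<integral>\<^sup>+x. \<pi> x * ?h x \<partial>count_space UNIV)" .
  have le: "\<pi> x * ?Ph x \<le> \<pi> x * ?h x" for x
    by (intro mult_left_mono hit_ever_superharmonic) simp
  have "(\<integral>\<^sup>+x. \<pi> x * ?h x - \<pi> x * ?Ph x \<partial>count_space UNIV) = 0"
    using int_le fin eq le by (subst nn_integral_diff) auto
  then have "\<pi> x * ?h x - \<pi> x * ?Ph x = 0" for x
    by (simp add: nn_integral_0_iff_AE AE_count_space)
  then have "\<pi> x * ?h x \<le> \<pi> x * ?Ph x" for x
    by (metis diff_eq_0_iff_ennreal)
  moreover have "\<pi> x < \<infinity>" for x
    using inv by (auto simp: invariant_measure_def)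
  ultimately have ge: "?h x \<le> ?Ph x" for x
    using irreducible_invariant_pos[OF irr inv] by (metis ennreal_mult_le_mult_iff infinity_ennreal_def less_irrefl)
  have step: "?h z = 1" if "?h y = 1" "z \<in> set_pmf (K y)" for y z
    by (rule nn_integral_pmf_eq_1D[where f = ?h, OF hit_ever_le_1 _ that(2)])
       (metis antisym ge hit_ever_superharmonic that(1))
  have "?h z = 1" if "z \<in> set_pmf (nstep K n a)" for n z
    using that by (induction n arbitrary: z) (auto intro: step)
  moreover obtain n where "pmf (nstep K n a) x > 0"
    using irr by (auto simp: irreducible_chain_def)
  ultimately show ?thesis
    by (metis less_irrefl set_pmf_iff)
qed

lemma recurrent_chain_hit_ever:
  fixes K :: "'s::countable \<Rightarrow> 's pmf"
  assumes "recurrent_chain K"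
  shows "hit_ever K a x = 1"
proof -
  have "AE \<omega> in paths K x. \<forall>y\<in>UNIV. \<exists>\<^sub>\<infinity>n. \<omega> n = y"
    using assms unfolding recurrent_chain_def visits_infinitely_often_def by blast
  then have "AE \<omega> in paths K x. \<exists>n. \<omega> n = a"
    by (rule eventually_mono) (blast dest: INFM_EX)
  then show ?thesis by (simp add: AE_hit_iff)
qed

text \<open>
  Detailed balance says precisely that time reversal leaves the transition matrix unchanged.
\<close>

lemma reversed_reversible:
  assumes irr: "irreducible_chain K" and inv: "invariant_measure K \<pi>" and rev: "reversible_chain K \<pi>"
  shows "reversed K \<pi> = K"
proof (intro ext pmf_eqI)
  fix x y
  have fin: "\<pi> z < \<infinity>" "\<pi> z \<noteq> 0" for z
    using inv irreducible_invariant_pos[OF irr inv] by (auto simp: invariant_measure_def)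
  obtain p q where pq: "\<pi> x = ennreal p" "\<pi> y = ennreal q" "0 < p" "0 < q"
    using fin[of x] fin[of y] by (cases "\<pi> x"; cases "\<pi> y") auto
  have "\<pi> x * pmf (K x) y = \<pi> y * pmf (K y) x"
    using rev by (simp add: reversible_chain_def)
  then have "p * pmf (K x) y = q * pmf (K y) x"
    using pq by (simp flip: ennreal_mult)
  then have "q / p * pmf (K y) x = pmf (K x) y"
    using pq by (simp add: field_simps)
  then show "pmf (reversed K \<pi> x) y = pmf (K x) y"
    using pq by (simp add: pmf_reversed[OF inv fin(2)] divide_ennreal)
qed

section \<open>The measure of the cat and mouse chain\<close>

text \<open>
  The \<open>n\<close>-th summand in the definition of \<open>cm_measure\<close>. For a loopless kernel and \<open>n \<ge> 1\<close> its expectation is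
  the probability that the first visit to \<open>y\<close> at a positive time takes place at \<open>n + 1\<close>.
\<close>

definition meeting_term :: "('s \<Rightarrow> 's pmf) \<Rightarrow> 's \<Rightarrow> (nat \<Rightarrow> 's) \<Rightarrow> nat \<Rightarrow> ennreal" where
  "meeting_term K y \<omega> n =
    (if 1 \<le> n \<and> enat n \<le> hitting_time y \<omega> then ennreal (pmf (K (\<omega> n)) y) else 0)"

lemma le_hitting_time_iff: "enat n \<le> hitting_time y \<omega> \<longleftrightarrow> (\<forall>k<n. 0 < k \<longrightarrow> \<omega> k \<noteq> y)"
proof -
  have "enat n \<le> hitting_time y \<omega> \<longleftrightarrow> (\<forall>k. 0 < k \<and> \<omega> k = y \<longrightarrow> n \<le> k)"
    unfolding hitting_time_def le_Inf_iff by auto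
  then show ?thesis
    by (metis not_le)
qed

lemma meeting_term_0 [simp]: "meeting_term K y \<omega> 0 = 0"
  by (simp add: meeting_term_def)

lemma meeting_term_case_nat:
  "meeting_term K y (case_nat x \<omega>) (Suc 0) = ennreal (pmf (K (\<omega> 0)) y)"
  "meeting_term K y (case_nat x \<omega>) (Suc (Suc n)) = (if \<omega> 0 = y then 0 else meeting_term K y \<omega> (Suc n))"
proof -
  show "meeting_term K y (case_nat x \<omega>) (Suc 0) = ennreal (pmf (K (\<omega> 0)) y)"
    by (simp add: meeting_term_def le_hitting_time_iff)
  have "(\<forall>k<Suc (Suc n). 0 < k \<longrightarrow> case_nat x \<omega> k \<noteq> y) \<longleftrightarrow> \<omega> 0 \<noteq> y \<and> (\<forall>k<Suc n. 0 < k \<longrightarrow> \<omega> k \<noteq> y)"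
    unfolding All_less_Suc2 by auto
  then show "meeting_term K y (case_nat x \<omega>) (Suc (Suc n))
     = (if \<omega> 0 = y then 0 else meeting_term K y \<omega> (Suc n))"
    by (simp only: meeting_term_def le_hitting_time_iff) auto
qed

lemma measurable_meeting_term [measurable]:
  "(\<lambda>\<omega>. meeting_term K y \<omega> n) \<in> borel_measurable traj_space"
proof -
  have [measurable]: "(\<lambda>\<omega>. ennreal (pmf (K (\<omega> n)) y)) \<in> borel_measurable traj_space"
    by (rule measurable_compose[of "\<lambda>\<omega>. \<omega> n" _ "count_space UNIV"]) auto
  show ?thesis
    unfolding meeting_term_def le_hitting_time_iff by measurable
qed

text \<open>
  By the interpretation of the summands as first-passage probabilities, the first \<open>N\<close> of them add up to
  the probability that the first visit to \<open>y\<close> after time 0 occurs between times 2 and \<open>N + 1\<close>; the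
  remaining value 1 of this time has probability \<open>p(x, y)\<close>. The proof uses first-step analysis on both sides;
  looplessness enters because the term with \<open>n\<close> equal to the hitting time is \<open>p(y, y)\<close>.
\<close>

lemma expected_meeting_sum:
  fixes K :: "'s::countable \<Rightarrow> 's pmf"
  assumes loop: "pmf (K y) y = 0"
  shows "(\<integral>\<^sup>+\<omega>. (\<Sum>n<N. meeting_term K y \<omega> (Suc n)) \<partial>paths K x) + pmf (K x) y
    = (\<integral>\<^sup>+z. hit_within K y N z \<partial>measure_pmf (K x))"
proof (induction N arbitrary: x)
  case 0
  have "(\<integral>\<^sup>+z. hit_within K y 0 z \<partial>measure_pmf (K x)) = (\<integral>\<^sup>+z. indicator {y} z \<partial>measure_pmf (K x))"
    by (intro nn_integral_cong) auto
  then show ?case by (simp add: emeasure_pmf_single)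
next
  case (Suc N)
  interpret P: prob_space "paths K z" for z by (rule prob_space_paths)
  let ?T = "\<lambda>\<omega>. \<Sum>n<N. meeting_term K y \<omega> (Suc n)"
  \<comment> \<open>After the first step the sum restarts from the new state, unless that state is already \<open>y\<close>.\<close>
  have shift: "(\<Sum>n<Suc N. meeting_term K y (case_nat x \<omega>) (Suc n))
    = ennreal (pmf (K (\<omega> 0)) y) + (if \<omega> 0 = y then 0 else ?T \<omega>)" for \<omega>
    by (simp add: sum.lessThan_Suc_shift meeting_term_case_nat del: sum.lessThan_Suc)
  have inner: "(\<integral>\<^sup>+\<omega>. (\<Sum>n<Suc N. meeting_term K y (case_nat x \<omega>) (Suc n)) \<partial>paths K z)
    = pmf (K z) y + (if z = y then 0 else \<integral>\<^sup>+\<omega>. ?T \<omega> \<partial>paths K z)" for z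
  proof -
    have "(\<integral>\<^sup>+\<omega>. (\<Sum>n<Suc N. meeting_term K y (case_nat x \<omega>) (Suc n)) \<partial>paths K z)
      = (\<integral>\<^sup>+\<omega>. ennreal (pmf (K z) y) + (if z = y then 0 else ?T \<omega>) \<partial>paths K z)"
      unfolding shift using AE_paths_start[of z K]
      by (intro nn_integral_cong_AE) (auto elim!: eventually_mono)
    also have "\<dots> = pmf (K z) y + (if z = y then 0 else \<integral>\<^sup>+\<omega>. ?T \<omega> \<partial>paths K z)"
      by (auto simp: nn_integral_add P.emeasure_space_1[simplified])
    finally show ?thesis .
  qed
  have "(\<integral>\<^sup>+\<omega>. (\<Sum>n<Suc N. meeting_term K y \<omega> (Suc n)) \<partial>paths K x)
    = (\<integral>\<^sup>+z. pmf (K z) y + (if z = y then 0 else \<integral>\<^sup>+\<omega>. ?T \<omega> \<partial>paths K z) \<partial>measure_pmf (K x))"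
    by (subst nn_integral_paths_first_step) (auto simp: inner simp del: sum.lessThan_Suc)
  moreover have "ennreal (pmf (K x) y) = (\<integral>\<^sup>+z. indicator {y} z \<partial>measure_pmf (K x))"
    by (simp add: emeasure_pmf_single)
  ultimately have "(\<integral>\<^sup>+\<omega>. (\<Sum>n<Suc N. meeting_term K y \<omega> (Suc n)) \<partial>paths K x) + pmf (K x) y
    = (\<integral>\<^sup>+z. pmf (K z) y + (if z = y then 0 else \<integral>\<^sup>+\<omega>. ?T \<omega> \<partial>paths K z) + indicator {y} z
       \<partial>measure_pmf (K x))"
    by (simp add: nn_integral_add del: sum.lessThan_Suc)
  also have "\<dots> = (\<integral>\<^sup>+z. hit_within K y (Suc N) z \<partial>measure_pmf (K x))"
    using loop by (intro nn_integral_cong) (auto simp: Suc[symmetric] add.commute)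
  finally show ?case .
qed

text \<open>
  Letting \<open>N\<close> grow in \<open>expected_meeting_sum\<close>: a visit to \<open>y\<close> at a positive time is almost sure, and
  the first one is later than 1 with probability \<open>1 - p(x, y)\<close>.
\<close>

lemma cm_measure_reversible:
  fixes K :: "'s::countable \<Rightarrow> 's pmf"
  assumes irr: "irreducible_chain K" and inv: "invariant_measure K \<pi>" and rev: "reversible_chain K \<pi>"
    and loop: "loopless_chain K" and h: "\<And>x. hit_ever K y x = 1"
  shows "cm_measure K \<pi> (x, y) = \<pi> x * ennreal (1 - pmf (K x) y)"
proof -
  let ?E = "\<integral>\<^sup>+\<omega>. (\<Sum>n. meeting_term K y \<omega> n) \<partial>paths K x"
  have "?E = (\<integral>\<^sup>+\<omega>. (\<Sum>n. meeting_term K y \<omega> (Suc n)) \<partial>paths K x)"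
    by (subst suminf_offset[where i = 1]) auto
  also have "\<dots> = (SUP N. \<Sum>n<N. \<integral>\<^sup>+\<omega>. meeting_term K y \<omega> (Suc n) \<partial>paths K x)"
    by (subst nn_integral_suminf) (simp_all add: suminf_eq_SUP)
  also have "\<dots> = (SUP N. \<integral>\<^sup>+\<omega>. (\<Sum>n<N. meeting_term K y \<omega> (Suc n)) \<partial>paths K x)"
    by (simp add: nn_integral_sum)
  finally have "?E + pmf (K x) y
     = (SUP N. (\<integral>\<^sup>+\<omega>. (\<Sum>n<N. meeting_term K y \<omega> (Suc n)) \<partial>paths K x) + pmf (K x) y)"
    by (simp add: ennreal_SUP_add_left)
  also have "\<dots> = (\<integral>\<^sup>+z. hit_ever K y z \<partial>measure_pmf (K x))"
    using loop by (simp add: expected_meeting_sum loopless_chain_def nn_integral_hit_ever)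
  also have "\<dots> = 1"
    by (simp add: h)
  finally have sum: "?E + pmf (K x) y = 1" .
  have "?E = ?E + pmf (K x) y - pmf (K x) y"
    by (rule ennreal_add_diff_cancel_right[symmetric]) simp
  also have "\<dots> = ennreal (1 - pmf (K x) y)"
    unfolding sum by (simp add: ennreal_minus flip: ennreal_1)
  finally have "?E = ennreal (1 - pmf (K x) y)" .
  then show ?thesis
    unfolding cm_measure_def reversed_reversible[OF irr inv rev] meeting_term_def by simp
qed

section \<open>Recurrence and mass of the cat and mouse chain\<close>

lemma ennreal_mult_complement: "\<pi> * ennreal (1 - pmf p y) + \<pi> * ennreal (pmf p y) = \<pi>"
proof -
  have "\<pi> * ennreal (1 - pmf p y) + \<pi> * ennreal (pmf p y) = \<pi> * ennreal (1 - pmf p y + pmf p y)"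
    by (subst ennreal_plus) (auto simp: pmf_le_1 distrib_left)
  then show ?thesis by simp
qed

text \<open>
  For the flow into \<open>(z, w)\<close>, the mouse either waits at \<open>w\<close>, or comes from a meeting at some \<open>x\<close>. The latter
  contributes \<open>\<pi>(x) p(x, z) p(x, w)\<close>, which is exactly the amount missing from
  \<open>\<pi>(x) (1 - p(x, w)) p(x, z)\<close> for a full step of the cat. The total is \<open>\<pi>(z) - \<pi>(w) p(w, z)\<close>, since a
  waiting mouse excludes \<open>x = w\<close>; reversibility turns it into the mass of \<open>(z, w)\<close>.
\<close>

lemma cat_mouse_invariant:
  assumes inv: "invariant_measure K \<pi>" and rev: "reversible_chain K \<pi>" and loop: "loopless_chain K"
  shows "push (cat_mouse K) (\<lambda>(x, y). \<pi> x * ennreal (1 - pmf (K x) y)) (z, w)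
    = \<pi> z * ennreal (1 - pmf (K z) w)"
proof -
  let ?p = "\<lambda>x y. ennreal (pmf (K x) y)" and ?q = "\<lambda>x y. ennreal (1 - pmf (K x) y)"
  have loop': "pmf (K y) y = 0" for y
    using loop by (simp add: loopless_chain_def)
  \<comment> \<open>\<open>g x\<close> is the flow from the meeting at \<open>x\<close>, \<open>k x\<close> that from \<open>(x, w)\<close> with the mouse waiting.\<close>
  define g where "g x = \<pi> x * (?p x z * ?p x w)" for x
  define k where "k x = (if x = w then 0 else \<pi> x * ?q x w * ?p x z)" for x
  let ?T = "push (cat_mouse K) (\<lambda>(x, y). \<pi> x * ?q x y) (z, w)"
  have split: "(case s of (x, y) \<Rightarrow> \<pi> x * ?q x y) * ennreal (pmf (cat_mouse K s) (z, w))
    = (case s of (x, y) \<Rightarrow> g x * indicator {x} y + k x * indicator {w} y)" for s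
  proof (cases s)
    case (Pair x y)
    show ?thesis
    proof (cases "x = y")
      case True
      then show ?thesis
        using Pair by (simp add: g_def k_def pmf_cat_mouse_eq loop' ennreal_mult indicator_def del: cat_mouse.simps)
    next
      case False
      then show ?thesis
        using Pair by (simp add: g_def k_def pmf_cat_mouse_neq indicator_def del: cat_mouse.simps)
    qed
  qed
  have "?T = (\<integral>\<^sup>+x. \<integral>\<^sup>+y. g x * indicator {x} y + k x * indicator {w} y
      \<partial>count_space UNIV \<partial>count_space UNIV)"
    unfolding push_def split
    by (subst nn_integral_fst_count_space[symmetric]) simp
  also have "\<dots> = (\<integral>\<^sup>+x. g x + k x \<partial>count_space UNIV)"
    by (simp add: nn_integral_add nn_integral_cmult_indicator)
  finally have T: "?T = (\<integral>\<^sup>+x. g x + k x \<partial>count_space UNIV)" .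
  have gk: "g x + k x + \<pi> w * ?p w z * indicator {w} x = \<pi> x * ?p x z" for x
  proof (cases "x = w")
    case True
    then show ?thesis by (simp add: g_def k_def loop')
  next
    case False
    then have "g x + k x = (\<pi> x * ?q x w + \<pi> x * ?p x w) * ?p x z"
      by (simp add: g_def k_def algebra_simps)
    with False show ?thesis
      by (simp add: ennreal_mult_complement)
  qed
  have "?T + \<pi> w * ?p w z = (\<integral>\<^sup>+x. g x + k x + \<pi> w * ?p w z * indicator {w} x \<partial>count_space UNIV)"
    by (simp add: T nn_integral_add nn_integral_cmult_indicator)
  also have "\<dots> = \<pi> z"
    using inv by (simp add: gk invariant_measure_def)
  also have "\<dots> = \<pi> z * ?q z w + \<pi> w * ?p w z"
    using rev ennreal_mult_complement[of "\<pi> z" "K z" w] by (metis reversible_chain_def)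
  finally have "?T + \<pi> w * ?p w z = \<pi> z * ?q z w + \<pi> w * ?p w z" .
  moreover have "\<pi> w * ?p w z < \<infinity>"
    using inv by (simp add: invariant_measure_def ennreal_mult_less_top)
  ultimately show ?thesis
    by (auto simp: add.commute[of _ "\<pi> w * ?p w z"] ennreal_add_left_cancel)
qed

text \<open>
  While the mouse stays at \<open>y\<close> the cat performs the recurrent chain \<open>K\<close> until it meets the mouse, so the
  successive meeting places are themselves a trajectory of \<open>K\<close>: the next one is the state to which the mouse
  jumps. In terms of the hitting probability \<open>h\<close> of \<open>(a, a)\<close>, the minimum principle applied to
  \<open>x \<mapsto> h (x, y)\<close> gives \<open>h (y, y) \<le> h (x, y)\<close>; therefore \<open>w \<mapsto> h (w, w)\<close> is superharmonic for \<open>K\<close>, and the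
  minimum principle applied to it compares \<open>h (y, y)\<close> with \<open>h (a, a) = 1\<close>.
\<close>

lemma hit_ever_cat_mouse_diagonal:
  assumes h: "\<And>y x. hit_ever K y x = 1"
  shows "hit_ever (cat_mouse K) (a, a) s = 1"
proof -
  let ?h = "hit_ever (cat_mouse K) (a, a)"
  have to_diag: "?h (y, y) \<le> ?h (x, y)" for x y
  proof -
    have "(\<integral>\<^sup>+z. ?h (z, y) \<partial>measure_pmf (K x)) \<le> ?h (x, y)" if "x \<noteq> y" for x
      using hit_ever_superharmonic[of "cat_mouse K" "(x, y)" "(a, a)"] that by simp
    from superharmonic_ge_hit_ever[of y K "\<lambda>x. ?h (x, y)" x, OF this] show ?thesis
      by (simp add: h)
  qed
  have super: "(\<integral>\<^sup>+w. ?h (w, w) \<partial>measure_pmf (K y)) \<le> ?h (y, y)" for y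
  proof -
    have "(\<integral>\<^sup>+w. ?h (w, w) \<partial>measure_pmf (K y))
      = (\<integral>\<^sup>+z. \<integral>\<^sup>+w. ?h (w, w) \<partial>measure_pmf (K y) \<partial>measure_pmf (K y))"
      by simp
    also have "\<dots> \<le> (\<integral>\<^sup>+z. \<integral>\<^sup>+w. ?h (z, w) \<partial>measure_pmf (K y) \<partial>measure_pmf (K y))"
      by (intro nn_integral_mono to_diag)
    also have "\<dots> \<le> ?h (y, y)"
      using hit_ever_superharmonic[of "cat_mouse K" "(y, y)" "(a, a)"]
      by (simp add: nn_integral_pair_pmf')
    finally show ?thesis .
  qed
  have "1 \<le> ?h (y, y)" for y
    using superharmonic_ge_hit_ever[of a K "\<lambda>w. ?h (w, w)" y, OF super] by (simp add: h)
  then have "1 \<le> ?h s"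
    using to_diag[of "snd s" "fst s"] order_trans by fastforce
  with hit_ever_le_1 show ?thesis by (rule antisym)
qed

lemma cm_marginal2_add:
  assumes inv: "invariant_measure K \<pi>"
    and \<nu>: "\<And>x y. cm_measure K \<pi> (x, y) = \<pi> x * ennreal (1 - pmf (K x) y)"
  shows "cm_marginal2 K \<pi> y + \<pi> y = total_mass \<pi>"
proof -
  have "\<pi> y = (\<integral>\<^sup>+x. \<pi> x * pmf (K x) y \<partial>count_space UNIV)"
    using inv by (simp add: invariant_measure_def)
  then have "cm_marginal2 K \<pi> y + \<pi> y
    = (\<integral>\<^sup>+x. \<pi> x * ennreal (1 - pmf (K x) y) + \<pi> x * pmf (K x) y \<partial>count_space UNIV)"
    by (subst nn_integral_add) (simp_all add: cm_marginal2_def \<nu>)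
  then show ?thesis
    by (simp add: ennreal_mult_complement total_mass_def)
qed

text \<open>
  Summing \<open>\<nu>\<^sub>2(y) + \<pi>(y) = |\<pi>|\<close> over the infinitely many \<open>y\<close> gives \<open>|\<nu>| + |\<pi>| = \<infinity>\<close>, which decides the case of
  finite \<open>|\<pi>|\<close>; when \<open>|\<pi>|\<close> is infinite, already \<open>\<nu>\<^sub>2(y)\<close> is infinite for every \<open>y\<close>.
\<close>

lemma total_mass_cat_mouse:
  assumes inf: "infinite (UNIV :: 's set)"
    and inv: "invariant_measure (K :: 's \<Rightarrow> 's pmf) \<pi>"
    and marg: "\<And>y. cm_marginal2 K \<pi> y + \<pi> y = total_mass \<pi>"
  shows "total_mass (cm_measure K \<pi>) = \<infinity>"
proof -
  have sum: "total_mass (cm_measure K \<pi>) = (\<integral>\<^sup>+y. cm_marginal2 K \<pi> y \<partial>count_space UNIV)"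
    unfolding total_mass_def cm_marginal2_def by (rule nn_integral_snd_count_space[symmetric])
  obtain x where x: "\<pi> x \<noteq> 0" "\<pi> x < \<infinity>"
    using inv by (auto simp: invariant_measure_def)
  have le: "f x \<le> (\<integral>\<^sup>+y. f y \<partial>count_space UNIV)" for f :: "'s \<Rightarrow> ennreal"
    by (rule nn_integral_ge_point) simp
  have pos: "total_mass \<pi> \<noteq> 0"
    using le[of \<pi>] x(1) by (auto simp: total_mass_def)
  show ?thesis
  proof (cases "total_mass \<pi> = \<infinity>")
    case True
    then have "cm_marginal2 K \<pi> x = \<infinity>"
      using marg[of x] x(2) by auto
    then show ?thesis
      using le[of "cm_marginal2 K \<pi>"] by (simp add: sum top_unique)
  next
    case False
    have "(\<integral>\<^sup>+y. cm_marginal2 K \<pi> y + \<pi> y \<partial>count_space UNIV) = \<infinity>"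
      using inf pos by (simp add: marg emeasure_count_space_infinite ennreal_mult_top)
    then have "total_mass (cm_measure K \<pi>) + total_mass \<pi> = \<infinity>"
      by (simp add: nn_integral_add sum total_mass_def[of \<pi>])
    with False show ?thesis by simp
  qed
qed

theorem proposition1:
  fixes K :: "'s::countable \<Rightarrow> 's pmf" and \<pi> :: "'s \<Rightarrow> ennreal"
  assumes "irreducible_chain K"
    and "aperiodic_chain K"
    and "loopless_chain K"
    and "invariant_measure K \<pi>"
    and "reversible_chain K \<pi>"
  shows "(total_mass \<pi> = 1 \<longrightarrow> (\<forall>y. cm_marginal2 K \<pi> y = 1 - \<pi> y)) \<and>
    (infinite (UNIV :: 's set) \<and> (total_mass \<pi> < \<infinity> \<or> recurrent_chain K) \<longrightarrow>
       null_recurrent_with (cat_mouse K) (cm_measure K \<pi>))"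
proof (intro conjI impI allI)
  note irr = assms(1) and loop = assms(3) and inv = assms(4) and rev = assms(5)
  have \<nu>: "cm_measure K \<pi> (x, y) = \<pi> x * ennreal (1 - pmf (K x) y)"
    if "\<And>y x. hit_ever K y x = 1" for x y
    by (rule cm_measure_reversible[OF irr inv rev loop that])
  note marg = cm_marginal2_add[OF inv \<nu>]
  {
    fix y assume total: "total_mass \<pi> = 1"
    then have "hit_ever K y x = 1" for y x
      by (intro finite_invariant_hit_ever[OF irr inv]) simp
    then have "cm_marginal2 K \<pi> y + \<pi> y = 1"
      using marg[of y] total by simp
    moreover have "\<pi> y \<noteq> \<top>"
      using inv by (auto simp: invariant_measure_def less_top)
    ultimately show "cm_marginal2 K \<pi> y = 1 - \<pi> y"
      by (metis ennreal_add_diff_cancel_right)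
  }
  assume "infinite (UNIV :: 's set) \<and> (total_mass \<pi> < \<infinity> \<or> recurrent_chain K)"
  then have inf: "infinite (UNIV :: 's set)" and "total_mass \<pi> < \<infinity> \<or> recurrent_chain K"
    by auto
  then have h: "hit_ever K y x = 1" for y x
    using finite_invariant_hit_ever[OF irr inv] recurrent_chain_hit_ever by blast
  have eq: "cm_measure K \<pi> = (\<lambda>(x, y). \<pi> x * ennreal (1 - pmf (K x) y))"
    using \<nu>[OF h] by (simp add: fun_eq_iff)
  obtain a :: 's where True by blast
  have a: "cm_measure K \<pi> (a, a) \<noteq> 0"
    using loop irreducible_invariant_pos[OF irr inv, of a] by (simp add: eq loopless_chain_def)
  have "invariant_measure (cat_mouse K) (cm_measure K \<pi>)"
    unfolding invariant_measure_def
  proof (intro conjI allI)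
    show "\<exists>s. cm_measure K \<pi> s \<noteq> 0"
      using a by blast
    show "cm_measure K \<pi> s < \<infinity>" for s
      using inv by (cases s) (auto simp: eq invariant_measure_def ennreal_mult_less_top)
    show "(\<integral>\<^sup>+s. cm_measure K \<pi> s * ennreal (pmf (cat_mouse K s) t) \<partial>count_space UNIV)
        = cm_measure K \<pi> t" for t
      using cat_mouse_invariant[OF inv rev loop, of "fst t" "snd t"]
      unfolding eq push_def by (simp add: split_beta)
  qed
  then have "recurrent_with (cat_mouse K) (cm_measure K \<pi>)"
    using a by (intro recurrent_withI[of _ "(a, a)"] hit_ever_cat_mouse_diagonal h)
  moreover have "total_mass (cm_measure K \<pi>) = \<infinity>"
    by (intro total_mass_cat_mouse[OF inf inv] marg h)
  ultimately show "null_recurrent_with (cat_mouse K) (cm_measure K \<pi>)"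
    by (simp add: null_recurrent_with_def)
qed

end
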